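(* For each $N\ge1$ let $\eta^N(t)$ be an irreducible continuous-time Markov chain on a finite set $\Omega_N$ with jump rates $R_N(\eta,\xi)$, $\eta\ne\xi$, and unique stationary distribution $\nu_N$. Let $A_N\subset\Omega_N$ satisfy $\lim_{N\to\infty}\nu_N(A_N)=0$, let $H_N=\inf\{t>0:\eta^N(t)\in A_N\}$, and assume $T^{\rm mix}_N\ll r_N(A_N^c,A_N)^{-1}$. Then, for the chain started from $\nu_N$, $H_N/\mathbb E_{\nu_N}[H_N]$ converges in distribution, as $N\to\infty$, to a mean one exponential random variable.
   Context: $P_t(\eta,\xi)=\mathbb P_\eta[\eta^N(t)=\xi]$; the mixing time is $T^{\rm mix}_N=\inf\{t>0:\max_{\eta\in\Omega_N}\|P_t(\eta,\cdot)-\nu_N\|_{\rm TV}\le 1/4\}$. For $\xi\in\Omega_N$, $R_N(\xi,A_N)=\sum_{\zeta\in A_N}R_N(\xi,\zeta)$, and $r_N(A_N^c,A_N)=\frac1{\nu_N(A_N^c)}\sum_{\xi\in A_N^c}\nu_N(\xi)R_N(\xi,A_N)$. For positive sequences, $a_N\ll b_N$ means $a_N/b_N\to0$. $\mathbb P_\mu,\mathbb E_\mu$ denote the law and expectation of the chain started from the distribution $\mu$. *)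

theory Defs
  imports "HOL-Probability.Probability"
begin

text \<open>Generator (Q-matrix) of the chain on the finite state set Om with jump rates R;
  it vanishes outside Om x Om; the diagonal of R is ignored.\<close>
definition generator :: "'a set \<Rightarrow> ('a \<Rightarrow> 'a \<Rightarrow> real) \<Rightarrow> 'a \<Rightarrow> 'a \<Rightarrow> real" where
  "generator Om R x y =
     (if x \<in> Om \<and> y \<in> Om then
        (if x = y then - (\<Sum>z\<in>Om - {x}. R x z) else R x y)
      else 0)"

text \<open>Matrix powers over the index set Om.\<close>
fun matpow :: "'a set \<Rightarrow> ('a \<Rightarrow> 'a \<Rightarrow> real) \<Rightarrow> nat \<Rightarrow> 'a \<Rightarrow> 'a \<Rightarrow> real" where
  "matpow Om L 0 = (\<lambda>x y. if x = y then 1 else 0)"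
| "matpow Om L (Suc n) = (\<lambda>x y. \<Sum>z\<in>Om. matpow Om L n x z * L z y)"

text \<open>Transition function P_t = exp(t L) (matrix exponential series).\<close>
definition trans_fun :: "'a set \<Rightarrow> ('a \<Rightarrow> 'a \<Rightarrow> real) \<Rightarrow> real \<Rightarrow> 'a \<Rightarrow> 'a \<Rightarrow> real" where
  "trans_fun Om R t x y = (\<Sum>n. t ^ n / fact n * matpow Om (generator Om R) n x y)"

definition nonneg_rates :: "'a set \<Rightarrow> ('a \<Rightarrow> 'a \<Rightarrow> real) \<Rightarrow> bool" where
  "nonneg_rates Om R \<longleftrightarrow> (\<forall>x\<in>Om. \<forall>y\<in>Om. x \<noteq> y \<longrightarrow> R x y \<ge> 0)"

definition irreducible_chain :: "'a set \<Rightarrow> ('a \<Rightarrow> 'a \<Rightarrow> real) \<Rightarrow> bool" where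
  "irreducible_chain Om R \<longleftrightarrow>
     (\<forall>x\<in>Om. \<forall>y\<in>Om. (x, y) \<in> {(u, v). u \<in> Om \<and> v \<in> Om \<and> u \<noteq> v \<and> R u v > 0}\<^sup>*)"

definition is_distribution :: "'a set \<Rightarrow> ('a \<Rightarrow> real) \<Rightarrow> bool" where
  "is_distribution Om \<mu> \<longleftrightarrow> (\<forall>x. \<mu> x \<ge> 0) \<and> (\<forall>x. x \<notin> Om \<longrightarrow> \<mu> x = 0) \<and> (\<Sum>x\<in>Om. \<mu> x) = 1"

definition stationary :: "'a set \<Rightarrow> ('a \<Rightarrow> 'a \<Rightarrow> real) \<Rightarrow> ('a \<Rightarrow> real) \<Rightarrow> bool" where
  "stationary Om R \<nu> \<longleftrightarrow> is_distribution Om \<nu> \<and>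
     (\<forall>y\<in>Om. (\<Sum>x\<in>Om. \<nu> x * generator Om R x y) = 0)"

definition unique_stationary :: "'a set \<Rightarrow> ('a \<Rightarrow> 'a \<Rightarrow> real) \<Rightarrow> ('a \<Rightarrow> real) \<Rightarrow> bool" where
  "unique_stationary Om R \<nu> \<longleftrightarrow> stationary Om R \<nu> \<and> (\<forall>\<mu>. stationary Om R \<mu> \<longrightarrow> \<mu> = \<nu>)"

definition tv_dist :: "'a set \<Rightarrow> ('a \<Rightarrow> real) \<Rightarrow> ('a \<Rightarrow> real) \<Rightarrow> real" where
  "tv_dist Om \<mu> \<nu> = (\<Sum>x\<in>Om. \<bar>\<mu> x - \<nu> x\<bar>) / 2"

definition mixing_time :: "'a set \<Rightarrow> ('a \<Rightarrow> 'a \<Rightarrow> real) \<Rightarrow> ('a \<Rightarrow> real) \<Rightarrow> real" where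
  "mixing_time Om R \<nu> =
     Inf {t. t > 0 \<and> (\<forall>\<eta>\<in>Om. tv_dist Om (trans_fun Om R t \<eta>) \<nu> \<le> 1/4)}"

text \<open>Mean rate r_N(A^c, A) of jumps from A^c into A under the stationary law.\<close>
definition rate_into :: "'a set \<Rightarrow> ('a \<Rightarrow> 'a \<Rightarrow> real) \<Rightarrow> ('a \<Rightarrow> real) \<Rightarrow> 'a set \<Rightarrow> real" where
  "rate_into Om R \<nu> A =
     (1 / (\<Sum>x\<in>Om - A. \<nu> x)) * (\<Sum>\<xi>\<in>Om - A. \<nu> \<xi> * (\<Sum>\<zeta>\<in>A. R \<xi> \<zeta>))"

text \<open>X is (a realisation on the probability space M of) the continuous-time Markov chain
  with state space Om, jump rates R and initial law \<mu>: states in Om, right-continuous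
  (piecewise constant) paths, and finite-dimensional distributions given by P_t.\<close>
definition ctmc_process :: "'b measure \<Rightarrow> (real \<Rightarrow> 'b \<Rightarrow> 'a) \<Rightarrow> 'a set \<Rightarrow>
     ('a \<Rightarrow> 'a \<Rightarrow> real) \<Rightarrow> ('a \<Rightarrow> real) \<Rightarrow> bool" where
  "ctmc_process M X Om R \<mu> \<longleftrightarrow>
     prob_space M \<and>
     (\<forall>t\<ge>0. X t \<in> measurable M (count_space UNIV)) \<and>
     (\<forall>\<omega>\<in>space M. \<forall>t\<ge>0. X t \<omega> \<in> Om) \<and>
     (\<forall>\<omega>\<in>space M. \<forall>t\<ge>0. \<exists>e>0. \<forall>s. t \<le> s \<and> s < t + e \<longrightarrow> X s \<omega> = X t \<omega>) \<and>
     (\<forall>n (ts :: nat \<Rightarrow> real) (xs :: nat \<Rightarrow> 'a). ts 0 = 0 \<longrightarrow> (\<forall>i<n. ts i \<le> ts (Suc i)) \<longrightarrow>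
        measure M {\<omega> \<in> space M. \<forall>i\<le>n. X (ts i) \<omega> = xs i} =
        \<mu> (xs 0) * (\<Prod>i<n. trans_fun Om R (ts (Suc i) - ts i) (xs i) (xs (Suc i))))"

definition hitting_time :: "(real \<Rightarrow> 'b \<Rightarrow> 'a) \<Rightarrow> 'a set \<Rightarrow> 'b \<Rightarrow> real" where
  "hitting_time X A \<omega> = Inf {t. t > 0 \<and> X t \<omega> \<in> A}"

end

theory Submission
  imports Defs
begin

text \<open>
  Let \<open>f t\<close> be the stationary probability that \<open>A\<close> is avoided up to time \<open>t\<close>. A gap of length \<open>S\<close>
  inserted between two time windows makes them independent up to an error \<open>D\<close>, the distance from
  equilibrium at time \<open>S\<close>, while by stationarity \<open>A\<close> is entered during the gap with probability at
  most \<open>r S\<close>. Hence \<open>f (t + s)\<close> differs from \<open>f t * f s\<close> by at most \<open>D + r S\<close>. Taking for \<open>S\<close> a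
  slowly growing multiple of the mixing time makes \<open>D\<close> and \<open>r S\<close> small, by assumption. So if
  \<open>\<theta>\<close> is the time with \<open>f \<theta> = 1/e\<close>, then \<open>f (\<theta> u)\<close> tends to \<open>exp (- u)\<close>. The one-sided bound
  \<open>f (t + S + s) \<le> f t (f s + D)\<close> makes \<open>u \<mapsto> f (\<theta> u)\<close> decay geometrically, uniformly in \<open>N\<close>, so by
  dominated convergence the mean hitting time, which is the integral of \<open>f\<close>, is asymptotic to \<open>\<theta>\<close>.
\<close>

section \<open>The matrix exponential\<close>

definition matexp :: "'a set \<Rightarrow> ('a \<Rightarrow> 'a \<Rightarrow> real) \<Rightarrow> real \<Rightarrow> 'a \<Rightarrow> 'a \<Rightarrow> real" where
  "matexp Om L t x y = (\<Sum>n. t ^ n / fact n * matpow Om L n x y)"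

lemma sum_abs_matpow_le:
  assumes "finite Om" "x \<in> Om"
  shows "(\<Sum>y\<in>Om. \<bar>matpow Om L n x y\<bar>) \<le> (\<Sum>z\<in>Om. \<Sum>y\<in>Om. \<bar>L z y\<bar>) ^ n"
proof (induction n)
  case 0
  have "(\<Sum>y\<in>Om. \<bar>matpow Om L 0 x y\<bar>) = (\<Sum>y\<in>Om. if x = y then 1 else 0)"
    by (intro sum.cong) auto
  then show ?case using assms by simp
next
  case (Suc n)
  let ?K = "\<Sum>z\<in>Om. \<Sum>y\<in>Om. \<bar>L z y\<bar>"
  have "(\<Sum>y\<in>Om. \<bar>matpow Om L (Suc n) x y\<bar>) \<le> (\<Sum>y\<in>Om. \<Sum>z\<in>Om. \<bar>matpow Om L n x z\<bar> * \<bar>L z y\<bar>)"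
    by (auto intro!: sum_mono order_trans[OF sum_abs] simp: abs_mult)
  also have "\<dots> = (\<Sum>z\<in>Om. \<bar>matpow Om L n x z\<bar> * (\<Sum>y\<in>Om. \<bar>L z y\<bar>))"
    by (subst sum.swap) (simp add: sum_distrib_left)
  also have "\<dots> \<le> (\<Sum>z\<in>Om. \<bar>matpow Om L n x z\<bar> * ?K)"
    using assms by (intro sum_mono mult_left_mono member_le_sum) (auto intro: sum_nonneg)
  also have "\<dots> = (\<Sum>z\<in>Om. \<bar>matpow Om L n x z\<bar>) * ?K"
    by (simp add: sum_distrib_right)
  also have "\<dots> \<le> ?K ^ n * ?K"
    by (intro mult_right_mono Suc) (auto intro!: sum_nonneg)
  finally show ?case by (simp add: mult.commute)
qed

lemma summable_norm_matexp:
  assumes "finite Om" "x \<in> Om" "y \<in> Om"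
  shows "summable (\<lambda>n. norm (t ^ n / fact n * matpow Om L n x y))"
proof (rule summable_norm_comparison_test)
  let ?K = "\<Sum>z\<in>Om. \<Sum>y\<in>Om. \<bar>L z y\<bar>"
  show "summable (\<lambda>n. (\<bar>t\<bar> * ?K) ^ n / fact n)"
    using summable_exp_generic[of "\<bar>t\<bar> * ?K"] by (simp add: divide_inverse mult.commute)
  have "norm (t ^ n / fact n * matpow Om L n x y) \<le> (\<bar>t\<bar> * ?K) ^ n / fact n" for n
  proof -
    have "\<bar>matpow Om L n x y\<bar> \<le> (\<Sum>y\<in>Om. \<bar>matpow Om L n x y\<bar>)"
      using assms by (intro member_le_sum) auto
    also have "\<dots> \<le> ?K ^ n" using assms(1,2) by (rule sum_abs_matpow_le)
    finally have "\<bar>t\<bar> ^ n / fact n * \<bar>matpow Om L n x y\<bar> \<le> \<bar>t\<bar> ^ n / fact n * ?K ^ n"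
      by (intro mult_left_mono) auto
    then show ?thesis by (simp add: abs_mult power_abs power_mult_distrib)
  qed
  then show "\<exists>N. \<forall>n\<ge>N. norm (t ^ n / fact n * matpow Om L n x y) \<le> (\<bar>t\<bar> * ?K) ^ n / fact n"
    by blast
qed

lemma matexp_sums:
  assumes "finite Om" "x \<in> Om" "y \<in> Om"
  shows "(\<lambda>n. t ^ n / fact n * matpow Om L n x y) sums matexp Om L t x y"
  unfolding matexp_def
  by (rule summable_sums[OF summable_norm_cancel[OF summable_norm_matexp[OF assms]]])

lemma matexp_zero: "matexp Om L 0 x y = (if x = y then 1 else 0)"
  using powser_zero[of "\<lambda>n. matpow Om L n x y / fact n"] by (simp add: matexp_def mult.commute)

lemma matpow_add:
  assumes "finite Om" "y \<in> Om"
  shows "matpow Om L (m + n) x y = (\<Sum>z\<in>Om. matpow Om L m x z * matpow Om L n z y)"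
  using assms(2)
proof (induction n arbitrary: y)
  case 0
  then show ?case using assms(1) by (simp add: if_distrib cong: if_cong)
next
  case (Suc n)
  have "matpow Om L (m + Suc n) x y
      = (\<Sum>w\<in>Om. (\<Sum>z\<in>Om. matpow Om L m x z * matpow Om L n z w) * L w y)"
    using Suc.IH by simp
  also have "\<dots> = (\<Sum>z\<in>Om. matpow Om L m x z * matpow Om L (Suc n) z y)"
    by (simp add: sum_distrib_left sum_distrib_right mult.assoc) (rule sum.swap)
  finally show ?case .
qed

lemma matexp_add:
  assumes "finite Om" "x \<in> Om" "y \<in> Om"
  shows "matexp Om L (s + t) x y = (\<Sum>z\<in>Om. matexp Om L s x z * matexp Om L t z y)"
proof (rule sums_unique2)
  let ?a = "\<lambda>s x y n. s ^ n / fact n * matpow Om L n x y"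
  have "(\<lambda>n. \<Sum>z\<in>Om. \<Sum>i\<le>n. ?a s x z i * ?a t z y (n - i)) sums
      (\<Sum>z\<in>Om. matexp Om L s x z * matexp Om L t z y)"
    unfolding matexp_def using assms by (intro sums_sum Cauchy_product_sums summable_norm_matexp)
  moreover have "(\<Sum>z\<in>Om. \<Sum>i\<le>n. ?a s x z i * ?a t z y (n - i)) = ?a (s + t) x y n" for n
  proof -
    have "(\<Sum>z\<in>Om. \<Sum>i\<le>n. ?a s x z i * ?a t z y (n - i))
        = (\<Sum>i\<le>n. s ^ i / fact i * (t ^ (n - i) / fact (n - i)) *
            (\<Sum>z\<in>Om. matpow Om L i x z * matpow Om L (n - i) z y))"
      by (subst sum.swap) (simp add: sum_distrib_left ac_simps)
    also have "\<dots> = (\<Sum>i\<le>n. (n choose i) * s ^ i * t ^ (n - i)) / fact n * matpow Om L n x y"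
      using assms(1,3) unfolding sum_divide_distrib sum_distrib_right
      by (intro sum.cong) (simp_all add: matpow_add[symmetric] binomial_fact)
    finally show ?thesis by (simp add: binomial_ring)
  qed
  ultimately show "?a (s + t) x y sums (\<Sum>z\<in>Om. matexp Om L s x z * matexp Om L t z y)" by simp
qed (use assms in \<open>rule matexp_sums\<close>)

lemma DERIV_matexp_zero:
  assumes "finite Om" "x \<in> Om" "y \<in> Om"
  shows "((\<lambda>t. matexp Om L t x y) has_field_derivative L x y) (at 0)"
proof -
  let ?c = "\<lambda>n. matpow Om L n x y / fact n"
  have "matexp Om L t x y = (\<Sum>n. ?c n * t ^ n)" for t
    unfolding matexp_def by (simp add: mult.commute)
  moreover have "summable (\<lambda>n. ?c n * t ^ n)" for t
    using matexp_sums[OF assms] by (simp add: sums_iff mult.commute)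
  ultimately have "((\<lambda>t. matexp Om L t x y) has_field_derivative (\<Sum>n. diffs ?c n * 0 ^ n)) (at 0)"
    using termdiffs_strong_converges_everywhere[of ?c 0] by presburger
  also have "(\<Sum>n. diffs ?c n * 0 ^ n) = (\<Sum>z\<in>Om. (if x = z then 1 else 0) * L z y)"
    unfolding powser_zero by (simp add: diffs_def)
  also have "\<dots> = L x y"
    using assms by (simp add: if_distrib[where f = "\<lambda>a. a * _"] cong: if_cong)
  finally show ?thesis .
qed

lemma matexp_invariant_left:
  assumes "finite Om" "\<And>y. y \<in> Om \<Longrightarrow> (\<Sum>x\<in>Om. \<mu> x * L x y) = 0" "y \<in> Om"
  shows "(\<Sum>x\<in>Om. \<mu> x * matexp Om L t x y) = \<mu> y"
proof -
  have pow: "(\<Sum>x\<in>Om. \<mu> x * matpow Om L n x y) = (if n = 0 then \<mu> y else 0)" if "y \<in> Om" for n y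
    using that
  proof (induction n arbitrary: y)
    case 0
    then show ?case using assms(1) by (simp add: if_distrib cong: if_cong)
  next
    case (Suc n)
    have "(\<Sum>x\<in>Om. \<mu> x * matpow Om L (Suc n) x y)
        = (\<Sum>z\<in>Om. (\<Sum>x\<in>Om. \<mu> x * matpow Om L n x z) * L z y)"
      by (simp add: sum_distrib_left sum_distrib_right mult.assoc) (rule sum.swap)
    then show ?case using Suc assms(2) by (cases n) simp_all
  qed
  have "(\<lambda>n. \<Sum>x\<in>Om. \<mu> x * (t ^ n / fact n * matpow Om L n x y)) sums
      (\<Sum>x\<in>Om. \<mu> x * matexp Om L t x y)"
    using assms by (intro sums_sum sums_mult matexp_sums)
  moreover have "(\<Sum>x\<in>Om. \<mu> x * (t ^ n / fact n * matpow Om L n x y))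
      = (if n = 0 then \<mu> y else 0)" for n
  proof -
    have "(\<Sum>x\<in>Om. \<mu> x * (t ^ n / fact n * matpow Om L n x y))
        = t ^ n / fact n * (\<Sum>x\<in>Om. \<mu> x * matpow Om L n x y)"
      by (simp add: sum_distrib_left ac_simps)
    then show ?thesis using pow[OF assms(3)] by simp
  qed
  ultimately show ?thesis
    using sums_single[of 0 "\<lambda>_. \<mu> y"] sums_unique2 by simp
qed

lemma matexp_row_sum:
  assumes "finite Om" "\<And>x. x \<in> Om \<Longrightarrow> (\<Sum>y\<in>Om. L x y) = 0" "x \<in> Om"
  shows "(\<Sum>y\<in>Om. matexp Om L t x y) = 1"
proof -
  have pow: "(\<Sum>y\<in>Om. matpow Om L n x y) = (if n = 0 then 1 else 0)" for n
  proof (cases n)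
    case 0
    then show ?thesis using assms by simp
  next
    case (Suc m)
    have "(\<Sum>y\<in>Om. matpow Om L n x y) = (\<Sum>z\<in>Om. matpow Om L m x z * (\<Sum>y\<in>Om. L z y))"
      unfolding Suc by (simp add: sum_distrib_left) (rule sum.swap)
    then show ?thesis using Suc assms(2) by simp
  qed
  have "(\<lambda>n. \<Sum>y\<in>Om. t ^ n / fact n * matpow Om L n x y) sums (\<Sum>y\<in>Om. matexp Om L t x y)"
    using assms by (intro sums_sum matexp_sums)
  also have "(\<lambda>n. \<Sum>y\<in>Om. t ^ n / fact n * matpow Om L n x y) = (\<lambda>n. if n = 0 then 1 else 0)"
    unfolding sum_distrib_left[symmetric] pow by auto
  finally show ?thesis using sums_single[of 0 "\<lambda>_. 1 :: real"] sums_unique2 by blast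
qed

lemma matpow_add_scalar:
  assumes "finite Om" "y \<in> Om"
  shows "matpow Om (\<lambda>x y. L x y + (if x = y then c else 0)) n x y
    = (\<Sum>k\<le>n. (n choose k) * matpow Om L k x y * c ^ (n - k))"
  using assms(2)
proof (induction n arbitrary: y)
  case (Suc n)
  let ?K = "\<lambda>x y. L x y + (if x = y then c else 0)"
  let ?a = "\<lambda>k. matpow Om L k x y"
  have shifted: "(\<Sum>z\<in>Om. (\<Sum>k\<le>n. (n choose k) * matpow Om L k x z * c ^ (n - k)) * L z y)
      = (\<Sum>k\<le>n. (n choose k) * ?a (Suc k) * c ^ (n - k))"
    by (simp add: sum_distrib_left sum_distrib_right ac_simps) (rule sum.swap)
  have scaled: "(\<Sum>k\<le>n. (n choose k) * ?a k * c ^ (n - k)) * c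
      = c ^ Suc n * ?a 0 + (\<Sum>k\<le>n. (n choose Suc k) * ?a (Suc k) * c ^ (n - k))"
  proof -
    have "(\<Sum>k\<le>n. (n choose k) * ?a k * c ^ (n - k)) * c
        = (\<Sum>k\<le>Suc n. (n choose k) * ?a k * c ^ (Suc n - k))"
      by (simp add: sum_distrib_left sum_distrib_right Suc_diff_le binomial_eq_0 ac_simps)
    then show ?thesis by (subst (asm) sum.atMost_Suc_shift) simp
  qed
  have "matpow Om ?K (Suc n) x y = (\<Sum>z\<in>Om. matpow Om ?K n x z * L z y) + matpow Om ?K n x y * c"
    using assms(1) Suc.prems
    by (simp add: distrib_left sum.distrib if_distrib[where f = "\<lambda>a. _ * a"] cong: if_cong)
  also have "\<dots> = (\<Sum>k\<le>n. (n choose k) * ?a (Suc k) * c ^ (n - k)) +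
      (c ^ Suc n * ?a 0 + (\<Sum>k\<le>n. (n choose Suc k) * ?a (Suc k) * c ^ (n - k)))"
    using Suc shifted scaled by simp
  also have "\<dots> = (\<Sum>k\<le>Suc n. (Suc n choose k) * ?a k * c ^ (Suc n - k))"
    by (subst sum.atMost_Suc_shift) (simp add: sum.distrib[symmetric] algebra_simps)
  finally show ?case .
qed simp

lemma matexp_add_scalar:
  assumes "finite Om" "x \<in> Om" "y \<in> Om"
  shows "matexp Om (\<lambda>x y. L x y + (if x = y then c else 0)) t x y = matexp Om L t x y * exp (t * c)"
proof (rule sums_unique2)
  let ?K = "\<lambda>x y. L x y + (if x = y then c else 0)"
  show "(\<lambda>n. t ^ n / fact n * matpow Om ?K n x y) sums matexp Om ?K t x y"
    using assms by (rule matexp_sums)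
  have "(\<Sum>i\<le>n. (t ^ i / fact i * matpow Om L i x y) * ((t * c) ^ (n - i) /\<^sub>R fact (n - i)))
      = t ^ n / fact n * matpow Om ?K n x y" for n
  proof -
    have "t ^ i * t ^ (n - i) = t ^ n" if "i \<le> n" for i using that by (simp flip: power_add)
    then show ?thesis
      unfolding matpow_add_scalar[OF assms(1,3)] sum_distrib_left
      by (intro sum.cong) (simp_all add: binomial_fact power_mult_distrib field_simps)
  qed
  moreover have "(\<lambda>n. \<Sum>i\<le>n.
        (t ^ i / fact i * matpow Om L i x y) * ((t * c) ^ (n - i) /\<^sub>R fact (n - i)))
      sums (matexp Om L t x y * exp (t * c))"
    unfolding matexp_def exp_def using assms summable_norm_exp
    by (intro Cauchy_product_sums summable_norm_matexp)
  ultimately show "(\<lambda>n. t ^ n / fact n * matpow Om ?K n x y) sums (matexp Om L t x y * exp (t * c))"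
    by simp
qed

lemma matpow_nonneg:
  assumes "\<And>x y. x \<in> Om \<Longrightarrow> y \<in> Om \<Longrightarrow> L x y \<ge> 0" "y \<in> Om"
  shows "matpow Om L n x y \<ge> 0"
  using assms(2) by (induction n arbitrary: y) (auto intro!: sum_nonneg mult_nonneg_nonneg assms)

lemma matpow_le_matexp:
  assumes "finite Om" "\<And>x y. x \<in> Om \<Longrightarrow> y \<in> Om \<Longrightarrow> L x y \<ge> 0" "x \<in> Om" "y \<in> Om" "t \<ge> 0"
  shows "t ^ n / fact n * matpow Om L n x y \<le> matexp Om L t x y"
proof -
  have "t ^ k / fact k * matpow Om L k x y \<ge> 0" for k
    using assms by (intro mult_nonneg_nonneg matpow_nonneg) auto
  then have "(\<Sum>k\<in>{n}. t ^ k / fact k * matpow Om L k x y)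
      \<le> (\<Sum>k. t ^ k / fact k * matpow Om L k x y)"
    using sums_summable[OF matexp_sums[OF assms(1,3,4)]] by (intro sum_le_suminf) auto
  then show ?thesis by (simp add: matexp_def)
qed

lemma matpow_pos_of_path:
  assumes "finite Om" "\<And>x y. x \<in> Om \<Longrightarrow> y \<in> Om \<Longrightarrow> L x y \<ge> 0"
    and "(x, y) \<in> {(u, v). u \<in> Om \<and> v \<in> Om \<and> L u v > 0}\<^sup>*"
  shows "\<exists>n. matpow Om L n x y > 0"
  using assms(3)
proof (induction rule: rtrancl_induct)
  case base
  then show ?case by (intro exI[of _ 0]) simp
next
  case (step y z)
  then obtain n where n: "matpow Om L n x y > 0" by blast
  have yz: "y \<in> Om" "z \<in> Om" "L y z > 0" using step.hyps by auto
  have "0 < matpow Om L n x y * L y z" using n yz by simp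
  also have "\<dots> \<le> matpow Om L (Suc n) x z"
    unfolding matpow.simps using assms(1,2) yz matpow_nonneg[of Om L _ _ x]
    by (intro member_le_sum[where f = "\<lambda>w. matpow Om L n x w * L w z"]) auto
  finally show ?case by blast
qed

section \<open>The transition function\<close>

lemma trans_fun_eq_matexp: "trans_fun Om R = matexp Om (generator Om R)"
  by (simp add: fun_eq_iff trans_fun_def matexp_def)

locale finite_rates =
  fixes Om :: "'a set" and R :: "'a \<Rightarrow> 'a \<Rightarrow> real"
  assumes finite_states: "finite Om"
    and nonneg_rates: "nonneg_rates Om R"
begin

abbreviation P :: "real \<Rightarrow> 'a \<Rightarrow> 'a \<Rightarrow> real" where
  "P \<equiv> trans_fun Om R"

lemma trans_fun_zero: "P 0 x y = (if x = y then 1 else 0)"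
  by (simp add: trans_fun_eq_matexp matexp_zero)

lemma chapman_kolmogorov:
  "x \<in> Om \<Longrightarrow> y \<in> Om \<Longrightarrow> P (s + t) x y = (\<Sum>z\<in>Om. P s x z * P t z y)"
  unfolding trans_fun_eq_matexp using finite_states by (rule matexp_add)

lemma trans_fun_row_sum:
  assumes "x \<in> Om"
  shows "(\<Sum>y\<in>Om. P t x y) = 1"
  unfolding trans_fun_eq_matexp
proof (rule matexp_row_sum[OF finite_states _ assms])
  fix x assume "x \<in> Om"
  then have "(\<Sum>y\<in>Om. generator Om R x y)
      = generator Om R x x + (\<Sum>y\<in>Om - {x}. generator Om R x y)"
    using finite_states by (intro sum.remove)
  also have "(\<Sum>y\<in>Om - {x}. generator Om R x y) = (\<Sum>y\<in>Om - {x}. R x y)"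
    using \<open>x \<in> Om\<close> by (intro sum.cong) (auto simp: generator_def)
  finally show "(\<Sum>y\<in>Om. generator Om R x y) = 0"
    using \<open>x \<in> Om\<close> by (simp add: generator_def)
qed

lemma trans_fun_jump_rate:
  assumes "x \<in> Om" "y \<in> Om" "x \<noteq> y"
  shows "((\<lambda>h. P h x y / h) \<longlongrightarrow> R x y) (at 0)"
  using DERIV_D[OF DERIV_matexp_zero[OF finite_states assms(1,2), of "generator Om R"]] assms
  by (simp add: trans_fun_eq_matexp matexp_zero generator_def)

text \<open>Uniformization: a multiple of the identity added to the generator makes all its entries
  nonnegative and multiplies its exponential by a positive scalar.\<close>

definition total_exit_rate :: real where
  "total_exit_rate = (\<Sum>x\<in>Om. - generator Om R x x)"

definition uniformized :: "'a \<Rightarrow> 'a \<Rightarrow> real" where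
  "uniformized x y = generator Om R x y + (if x = y then total_exit_rate else 0)"

lemma trans_fun_uniformized:
  assumes "x \<in> Om" "y \<in> Om"
  shows "P t x y = matexp Om uniformized t x y * exp (- t * total_exit_rate)"
  unfolding trans_fun_eq_matexp uniformized_def[abs_def] matexp_add_scalar[OF finite_states assms]
  by (simp add: mult.assoc flip: exp_add)

lemma uniformized_nonneg:
  assumes "x \<in> Om" "y \<in> Om"
  shows "uniformized x y \<ge> 0"
proof (cases "x = y")
  case True
  have "generator Om R z z \<le> 0" if "z \<in> Om" for z
    using that nonneg_rates by (auto simp: generator_def nonneg_rates_def intro!: sum_nonneg)
  then have "- generator Om R x x \<le> total_exit_rate"
    unfolding total_exit_rate_def using assms finite_states by (intro member_le_sum) auto
  then show ?thesis using True by (simp add: uniformized_def)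
next
  case False
  then show ?thesis using assms nonneg_rates
    by (simp add: uniformized_def generator_def nonneg_rates_def)
qed

lemma trans_fun_nonneg:
  assumes "t \<ge> 0" "x \<in> Om" "y \<in> Om"
  shows "P t x y \<ge> 0"
  using matpow_le_matexp[where L = uniformized and n = 0,
      OF finite_states uniformized_nonneg assms(2,3,1)]
  by (auto simp: trans_fun_uniformized[OF assms(2,3)] split: if_splits)

lemma trans_fun_pos:
  assumes "irreducible_chain Om R" "t > 0" "x \<in> Om" "y \<in> Om"
  shows "P t x y > 0"
proof -
  have "{(u, v). u \<in> Om \<and> v \<in> Om \<and> u \<noteq> v \<and> R u v > 0}
      \<subseteq> {(u, v). u \<in> Om \<and> v \<in> Om \<and> uniformized u v > 0}"
    by (auto simp: uniformized_def generator_def)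
  then have "(x, y) \<in> {(u, v). u \<in> Om \<and> v \<in> Om \<and> uniformized u v > 0}\<^sup>*"
    using assms(1,3,4) rtrancl_mono unfolding irreducible_chain_def by blast
  then obtain n where "matpow Om uniformized n x y > 0"
    using matpow_pos_of_path[where L = uniformized, OF finite_states uniformized_nonneg]
    by blast
  then have "0 < t ^ n / fact n * matpow Om uniformized n x y" using assms(2) by simp
  also have "\<dots> \<le> matexp Om uniformized t x y"
    using assms(2-4) by (intro matpow_le_matexp finite_states uniformized_nonneg) auto
  finally show ?thesis using assms by (simp add: trans_fun_uniformized)
qed

end

section \<open>Mixing\<close>

lemma sum_abs_transport_le:
  fixes K :: "'a \<Rightarrow> 'b \<Rightarrow> real"
  assumes "\<And>z. z \<in> C \<Longrightarrow> (\<Sum>y\<in>Om. \<bar>K z y - m y\<bar>) \<le> b"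
  shows "(\<Sum>y\<in>Om. \<bar>(\<Sum>z\<in>C. a z * K z y) - (\<Sum>z\<in>C. a z) * m y\<bar>) \<le> (\<Sum>z\<in>C. \<bar>a z\<bar>) * b"
proof -
  have "(\<Sum>y\<in>Om. \<bar>(\<Sum>z\<in>C. a z * K z y) - (\<Sum>z\<in>C. a z) * m y\<bar>)
      = (\<Sum>y\<in>Om. \<bar>\<Sum>z\<in>C. a z * (K z y - m y)\<bar>)"
    by (simp add: sum_distrib_right right_diff_distrib sum_subtractf)
  also have "\<dots> \<le> (\<Sum>y\<in>Om. \<Sum>z\<in>C. \<bar>a z\<bar> * \<bar>K z y - m y\<bar>)"
    by (intro sum_mono order_trans[OF sum_abs]) (simp add: abs_mult)
  also have "\<dots> = (\<Sum>z\<in>C. \<bar>a z\<bar> * (\<Sum>y\<in>Om. \<bar>K z y - m y\<bar>))"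
    by (subst sum.swap) (simp add: sum_distrib_left)
  also have "\<dots> \<le> (\<Sum>z\<in>C. \<bar>a z\<bar> * b)"
    using assms by (intro sum_mono mult_left_mono) auto
  finally show ?thesis by (simp add: sum_distrib_right)
qed

locale stationary_chain = finite_rates Om R for Om :: "'a set" and R +
  fixes \<nu> :: "'a \<Rightarrow> real"
  assumes irreducible: "irreducible_chain Om R"
    and stationary: "stationary Om R \<nu>"
begin

lemma nu_nonneg: "\<nu> x \<ge> 0" and nu_sum: "(\<Sum>x\<in>Om. \<nu> x) = 1"
  using stationary by (auto simp: stationary_def is_distribution_def)

lemma nu_trans_fun: "y \<in> Om \<Longrightarrow> (\<Sum>x\<in>Om. \<nu> x * P t x y) = \<nu> y"
  unfolding trans_fun_eq_matexp using finite_states stationary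
  by (intro matexp_invariant_left) (auto simp: stationary_def)

lemma nu_pos:
  assumes "y \<in> Om"
  shows "\<nu> y > 0"
proof -
  obtain x where x: "x \<in> Om" "\<nu> x > 0"
    using nu_nonneg nu_sum by (metis less_eq_real_def sum.neutral zero_neq_one)
  then have "0 < \<nu> x * P 1 x y" using trans_fun_pos irreducible assms by simp
  also have "\<dots> \<le> (\<Sum>x\<in>Om. \<nu> x * P 1 x y)"
    using x assms nu_nonneg trans_fun_nonneg finite_states by (intro member_le_sum) auto
  finally show ?thesis using assms by (simp add: nu_trans_fun)
qed

text \<open>The factor 2 makes the bound submultiplicative.\<close>

definition mixed :: "real \<Rightarrow> real \<Rightarrow> bool" where
  "mixed t D \<longleftrightarrow> t \<ge> 0 \<and> (\<forall>x\<in>Om. 2 * tv_dist Om (P t x) \<nu> \<le> D)"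

lemma mixed_iff: "mixed t D \<longleftrightarrow> t \<ge> 0 \<and> (\<forall>x\<in>Om. (\<Sum>y\<in>Om. \<bar>P t x y - \<nu> y\<bar>) \<le> D)"
  by (simp add: mixed_def tv_dist_def)

lemma mixed_bound_nonneg:
  assumes "mixed t D"
  shows "D \<ge> 0"
proof -
  obtain x where "x \<in> Om" using nu_sum by force
  then show ?thesis using assms unfolding mixed_iff by (meson abs_ge_zero order_trans sum_nonneg)
qed

lemma deviation_trans_fun:
  assumes "x \<in> Om" "y \<in> Om"
  shows "(\<Sum>z\<in>Om. (P s x z - \<nu> z) * P t z y) = P (s + t) x y - \<nu> y"
  using chapman_kolmogorov[OF assms, of s t] nu_trans_fun[OF assms(2), of t]
  by (simp add: left_diff_distrib sum_subtractf)

lemma deviation_sum: "x \<in> Om \<Longrightarrow> (\<Sum>z\<in>Om. P s x z - \<nu> z) = 0"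
  by (simp add: sum_subtractf trans_fun_row_sum nu_sum)

lemma deviation_contraction:
  assumes "x \<in> Om" "\<And>z. z \<in> Om \<Longrightarrow> (\<Sum>y\<in>Om. \<bar>P t z y - m y\<bar>) \<le> b"
  shows "(\<Sum>y\<in>Om. \<bar>P (s + t) x y - \<nu> y\<bar>) \<le> (\<Sum>y\<in>Om. \<bar>P s x y - \<nu> y\<bar>) * b"
  using sum_abs_transport_le[of Om "P t" m Om b "\<lambda>z. P s x z - \<nu> z"] assms
  by (simp add: deviation_trans_fun deviation_sum)

lemma mixed_add:
  assumes "mixed s a" "mixed t b"
  shows "mixed (s + t) (a * b)"
  unfolding mixed_iff
proof (intro conjI ballI)
  show "s + t \<ge> 0" using assms by (simp add: mixed_def)
  fix x assume x: "x \<in> Om"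
  have "(\<Sum>y\<in>Om. \<bar>P (s + t) x y - \<nu> y\<bar>) \<le> (\<Sum>y\<in>Om. \<bar>P s x y - \<nu> y\<bar>) * b"
    using x assms(2) unfolding mixed_iff by (intro deviation_contraction) auto
  also have "\<dots> \<le> a * b"
    using x assms mixed_bound_nonneg unfolding mixed_iff by (intro mult_right_mono) auto
  finally show "(\<Sum>y\<in>Om. \<bar>P (s + t) x y - \<nu> y\<bar>) \<le> a * b" .
qed

lemma mixed_power:
  assumes "mixed t D" "n > 0"
  shows "mixed (real n * t) (D ^ n)"
  using assms(2)
proof (induction n rule: nat_induct_non_zero)
  case (Suc n)
  have "mixed (t + real n * t) (D * D ^ n)" using assms(1) Suc.IH by (rule mixed_add)
  then show ?case by (simp add: algebra_simps)
qed (use assms(1) in simp)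

text \<open>Doeblin's argument: all rows of \<open>P 1\<close> dominate \<open>\<epsilon> \<nu>\<close>, and this common part does not
  contribute to the transport of a deviation, whose total mass is 0.\<close>

lemma doeblin_contraction:
  obtains q where "0 \<le> q" "q < 1"
    "\<And>s x. x \<in> Om \<Longrightarrow> (\<Sum>y\<in>Om. \<bar>P (s + 1) x y - \<nu> y\<bar>) \<le> (\<Sum>y\<in>Om. \<bar>P s x y - \<nu> y\<bar>) * q"
proof -
  define \<epsilon> where "\<epsilon> = Min ((\<lambda>(x, y). P 1 x y) ` (Om \<times> Om))"
  obtain x\<^sub>0 where x\<^sub>0: "x\<^sub>0 \<in> Om" using nu_sum by force
  have entries: "finite ((\<lambda>(x, y). P 1 x y) ` (Om \<times> Om))" "(\<lambda>(x, y). P 1 x y) ` (Om \<times> Om) \<noteq> {}"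
    using finite_states x\<^sub>0 by auto
  have \<epsilon>_pos: "\<epsilon> > 0"
    unfolding \<epsilon>_def Min_gr_iff[OF entries] using trans_fun_pos[OF irreducible] by auto
  have minorization: "\<epsilon> * \<nu> y \<le> P 1 x y" if "x \<in> Om" "y \<in> Om" for x y
  proof -
    have "\<nu> y \<le> 1" using member_le_sum[OF that(2), of \<nu>] nu_nonneg nu_sum finite_states by simp
    then have "\<epsilon> * \<nu> y \<le> \<epsilon>" using \<epsilon>_pos by simp
    also have "\<epsilon> \<le> P 1 x y" unfolding \<epsilon>_def using that by (intro Min_le entries) auto
    finally show ?thesis .
  qed
  have remainder: "(\<Sum>y\<in>Om. \<bar>P 1 x y - \<epsilon> * \<nu> y\<bar>) = 1 - \<epsilon>" if "x \<in> Om" for x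
  proof -
    have "(\<Sum>y\<in>Om. \<bar>P 1 x y - \<epsilon> * \<nu> y\<bar>) = (\<Sum>y\<in>Om. P 1 x y - \<epsilon> * \<nu> y)"
      using minorization that by (intro sum.cong) auto
    then show ?thesis using that
      by (simp add: sum_subtractf trans_fun_row_sum nu_sum flip: sum_distrib_left)
  qed
  show thesis
  proof
    have "0 \<le> (\<Sum>y\<in>Om. \<bar>P 1 x\<^sub>0 y - \<epsilon> * \<nu> y\<bar>)" by (intro sum_nonneg) auto
    then show "0 \<le> 1 - \<epsilon>" using remainder[OF x\<^sub>0] by simp
    show "1 - \<epsilon> < 1" using \<epsilon>_pos by simp
  qed (rule deviation_contraction[where m = "\<lambda>y. \<epsilon> * \<nu> y"], simp_all add: remainder)
qed

lemma exists_mixed: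
  assumes "D > 0"
  shows "\<exists>t>0. mixed t D"
proof -
  obtain q where q: "0 \<le> q" "q < 1"
    and contract: "\<And>s x. x \<in> Om \<Longrightarrow>
      (\<Sum>y\<in>Om. \<bar>P (s + 1) x y - \<nu> y\<bar>) \<le> (\<Sum>y\<in>Om. \<bar>P s x y - \<nu> y\<bar>) * q"
    using doeblin_contraction by blast
  have "mixed (real n) (2 * q ^ n)" for n
  proof (induction n)
    case 0
    have "(\<Sum>y\<in>Om. \<bar>P 0 x y - \<nu> y\<bar>) \<le> (\<Sum>y\<in>Om. P 0 x y + \<nu> y)" if "x \<in> Om" for x
      using nu_nonneg by (intro sum_mono abs_leI) (auto simp: trans_fun_zero)
    then show ?case by (simp add: mixed_iff sum.distrib trans_fun_row_sum nu_sum)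
  next
    case (Suc n)
    have "(\<Sum>y\<in>Om. \<bar>P (real n + 1) x y - \<nu> y\<bar>) \<le> 2 * q ^ n * q" if "x \<in> Om" for x
      using Suc that q(1) unfolding mixed_iff
      by (intro order_trans[OF contract] mult_right_mono) auto
    then show ?case by (simp add: mixed_iff ac_simps)
  qed
  moreover have "(\<lambda>n. 2 * q ^ n) \<longlonglongrightarrow> 0"
    using q by (intro tendsto_mult_right_zero LIMSEQ_power_zero) simp
  then have "eventually (\<lambda>n. 2 * q ^ n < D \<and> n > 0) sequentially"
    using assms by (intro eventually_conj order_tendstoD eventually_gt_at_top)
  then obtain n where "2 * q ^ n < D" "n > 0"
    using eventually_happens'[OF sequentially_bot] by blast
  ultimately have "mixed (real n) D" unfolding mixed_def by (meson less_imp_le order_trans)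
  then show ?thesis using \<open>n > 0\<close> by (intro exI[of _ "real n"]) simp
qed

lemma exists_mixed_near_mixing_time:
  assumes "\<delta> > 0"
  shows "\<exists>t>0. mixed t (1 / 2) \<and> t < mixing_time Om R \<nu> + \<delta>"
proof -
  let ?T = "{t. t > 0 \<and> (\<forall>\<eta>\<in>Om. tv_dist Om (P t \<eta>) \<nu> \<le> 1 / 4)}"
  have T: "t \<in> ?T \<longleftrightarrow> t > 0 \<and> mixed t (1 / 2)" for t by (auto simp: mixed_def)
  then have "?T \<noteq> {}" using exists_mixed[of "1 / 2"] by auto
  moreover have "bdd_below ?T" by (rule bdd_belowI[of _ 0]) auto
  ultimately obtain t where "t \<in> ?T" "t < Inf ?T + \<delta>"
    using cInf_lessD[of ?T "Inf ?T + \<delta>"] assms by auto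
  then show ?thesis using T unfolding mixing_time_def by blast
qed

end

section \<open>Finite-dimensional distributions\<close>

lemma nonneg_of_incr:
  fixes ts :: "nat \<Rightarrow> real"
  assumes "ts 0 = 0" "\<And>i. i < n \<Longrightarrow> ts i \<le> ts (Suc i)" "i \<le> n"
  shows "ts i \<ge> 0"
  using assms(3) by (induction i) (use assms in \<open>auto intro: order_trans\<close>)

context finite_rates
begin

text \<open>\<open>path_weight \<mu> ts C j z\<close> is the probability, for the chain started from \<open>\<mu>\<close> at time \<open>ts 0\<close>,
  to be in \<open>C i\<close> at time \<open>ts i\<close> for all \<open>i < j\<close> and in \<open>z\<close> at time \<open>ts j\<close>.\<close>

primrec path_weight ::
  "('a \<Rightarrow> real) \<Rightarrow> (nat \<Rightarrow> real) \<Rightarrow> (nat \<Rightarrow> 'a set) \<Rightarrow> nat \<Rightarrow> 'a \<Rightarrow> real" where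
  "path_weight \<mu> ts C 0 = \<mu>"
| "path_weight \<mu> ts C (Suc j) = (\<lambda>z. \<Sum>y\<in>C j. path_weight \<mu> ts C j y * P (ts (Suc j) - ts j) y z)"

lemma path_weight_nonneg:
  assumes "\<And>x. x \<in> Om \<Longrightarrow> \<mu> x \<ge> 0" "\<And>i. i < j \<Longrightarrow> ts i \<le> ts (Suc i)" "\<And>i. C i \<subseteq> Om" "z \<in> Om"
  shows "path_weight \<mu> ts C j z \<ge> 0"
  using assms(2,4)
proof (induction j arbitrary: z)
  case (Suc j)
  have "0 \<le> path_weight \<mu> ts C j y * P (ts (Suc j) - ts j) y z" if "y \<in> C j" for y
    using Suc assms(3) that by (intro mult_nonneg_nonneg trans_fun_nonneg) auto
  then show ?case by (auto intro: sum_nonneg)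
qed (use assms(1) in simp)

end

text \<open>After a time \<open>S\<close> with \<open>mixed S D\<close> the chain forgets its past up to \<open>D\<close>: the later constraints
  may be evaluated for the chain restarted from \<open>\<nu>\<close>.\<close>

lemma (in stationary_chain) path_weight_decouple:
  assumes \<mu>: "\<And>x. x \<in> Om \<Longrightarrow> \<mu> x \<ge> 0" and ts: "\<And>i. i < Suc k + m \<Longrightarrow> ts i \<le> ts (Suc i)"
    and C: "\<And>i. C i \<subseteq> Om" and mixed: "mixed (ts (Suc k) - ts k) D" and "i \<le> m"
  shows "(\<Sum>z\<in>Om. \<bar>path_weight \<mu> ts C (Suc k + i) z - (\<Sum>y\<in>C k. path_weight \<mu> ts C k y) *
      path_weight \<nu> (\<lambda>i. ts (Suc k + i) - ts (Suc k)) (\<lambda>i. C (Suc k + i)) i z\<bar>)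
    \<le> (\<Sum>y\<in>C k. path_weight \<mu> ts C k y) * D"
  using \<open>i \<le> m\<close>
proof (induction i)
  case 0
  have "(\<Sum>z\<in>Om. \<bar>P (ts (Suc k) - ts k) y z - \<nu> z\<bar>) \<le> D" if "y \<in> C k" for y
    using mixed C that unfolding mixed_iff by blast
  note sum_abs_transport_le[where K = "P (ts (Suc k) - ts k)" and a = "path_weight \<mu> ts C k",
      OF this]
  moreover have "\<bar>path_weight \<mu> ts C k y\<bar> = path_weight \<mu> ts C k y" if "y \<in> C k" for y
    using \<mu> ts C that by (intro abs_of_nonneg path_weight_nonneg) auto
  ultimately show ?case by simp
next
  case (Suc i)
  let ?F = "\<Sum>y\<in>C k. path_weight \<mu> ts C k y"
  let ?restarted = "path_weight \<nu> (\<lambda>i. ts (Suc k + i) - ts (Suc k)) (\<lambda>i. C (Suc k + i))"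
  let ?a = "\<lambda>y. path_weight \<mu> ts C (Suc k + i) y - ?F * ?restarted i y"
  let ?h = "ts (Suc (Suc k + i)) - ts (Suc k + i)"
  have "(\<Sum>z\<in>Om. \<bar>P ?h y z - 0\<bar>) \<le> 1" if "y \<in> C (Suc k + i)" for y
  proof -
    have "y \<in> Om" "?h \<ge> 0" using that C ts[of "Suc k + i"] Suc.prems by auto
    then show ?thesis using trans_fun_row_sum[of y ?h] by (simp add: trans_fun_nonneg)
  qed
  note sum_abs_transport_le[where K = "P ?h" and a = ?a, OF this]
  moreover have "path_weight \<mu> ts C (Suc k + Suc i) z - ?F * ?restarted (Suc i) z
      = (\<Sum>y\<in>C (Suc k + i). ?a y * P ?h y z) - (\<Sum>y\<in>C (Suc k + i). ?a y) * 0" for z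
    by (simp add: sum_distrib_left left_diff_distrib sum_subtractf mult.assoc)
  ultimately have "(\<Sum>z\<in>Om. \<bar>path_weight \<mu> ts C (Suc k + Suc i) z - ?F * ?restarted (Suc i) z\<bar>)
      \<le> (\<Sum>y\<in>C (Suc k + i). \<bar>?a y\<bar>)" by simp
  also have "\<dots> \<le> (\<Sum>y\<in>Om. \<bar>?a y\<bar>)" using C finite_states by (intro sum_mono2) auto
  also have "\<dots> \<le> ?F * D" using Suc by simp
  finally show ?case .
qed

locale ctmc = finite_rates Om R + prob_space M
  for Om :: "'a set" and R and M :: "'b measure" +
  fixes \<mu> :: "'a \<Rightarrow> real" and X :: "real \<Rightarrow> 'b \<Rightarrow> 'a"
  assumes process: "ctmc_process M X Om R \<mu>"
begin

lemma X_in_Om: "\<omega> \<in> space M \<Longrightarrow> t \<ge> 0 \<Longrightarrow> X t \<omega> \<in> Om"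
  and X_right_continuous:
    "\<omega> \<in> space M \<Longrightarrow> t \<ge> 0 \<Longrightarrow> \<exists>e>0. \<forall>s. t \<le> s \<and> s < t + e \<longrightarrow> X s \<omega> = X t \<omega>"
  using process unfolding ctmc_process_def by simp_all

lemma prob_path_states:
  assumes "ts 0 = 0" "\<And>i. i < n \<Longrightarrow> ts i \<le> ts (Suc i)"
  shows "prob {\<omega> \<in> space M. \<forall>i\<le>n. X (ts i) \<omega> = xs i} =
    \<mu> (xs 0) * (\<Prod>i<n. P (ts (Suc i) - ts i) (xs i) (xs (Suc i)))"
  using process assms unfolding ctmc_process_def by simp

lemma state_event:
  assumes "t \<ge> 0"
  shows "{\<omega> \<in> space M. Q (X t \<omega>)} \<in> events"
proof -
  have "X t \<in> measurable M (count_space UNIV)"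
    using process assms unfolding ctmc_process_def by simp
  from measurable_sets[OF this, of "Collect Q"] show ?thesis
    by (simp add: vimage_def Int_def conj_commute)
qed

lemma finite_times_event:
  assumes "finite I" "\<And>i. i \<in> I \<Longrightarrow> ts i \<ge> 0"
  shows "{\<omega> \<in> space M. \<forall>i\<in>I. Q i (X (ts i) \<omega>)} \<in> events"
  using assms by (intro sets.sets_Collect_finite_All state_event) auto

lemma prob_sum_states:
  assumes "t \<ge> 0" "C \<subseteq> Om" "{\<omega> \<in> space M. Q \<omega>} \<in> events"
  shows "prob {\<omega> \<in> space M. Q \<omega> \<and> X t \<omega> \<in> C} = (\<Sum>y\<in>C. prob {\<omega> \<in> space M. Q \<omega> \<and> X t \<omega> = y})"
proof -
  have "{\<omega> \<in> space M. Q \<omega> \<and> X t \<omega> = y} \<in> events" for y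
    using assms(1,3) by (intro sets.sets_Collect_conj state_event)
  moreover have "{\<omega> \<in> space M. Q \<omega> \<and> X t \<omega> \<in> C} = (\<Union>y\<in>C. {\<omega> \<in> space M. Q \<omega> \<and> X t \<omega> = y})" by auto
  ultimately show ?thesis
    using assms(2) finite_states
    by (auto intro!: finite_measure_finite_Union intro: finite_subset simp: disjoint_family_on_def)
qed

lemma prob_path_prefix:
  assumes ts: "ts 0 = 0" "\<And>i. i < n \<Longrightarrow> ts i \<le> ts (Suc i)" and C: "\<And>i. C i \<subseteq> Om" and "j \<le> n"
  shows "prob {\<omega> \<in> space M. (\<forall>i\<in>{..<j}. X (ts i) \<omega> \<in> C i) \<and> (\<forall>i\<in>{j..n}. X (ts i) \<omega> = xs i)}
    = path_weight \<mu> ts C j (xs j) * (\<Prod>i\<in>{j..<n}. P (ts (Suc i) - ts i) (xs i) (xs (Suc i)))"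
  using \<open>j \<le> n\<close>
proof (induction j arbitrary: xs)
  case 0
  then show ?case using prob_path_states[OF ts, of n xs] by (simp add: atLeast0LessThan Ball_def)
next
  case (Suc j)
  let ?Q = "\<lambda>\<omega>. (\<forall>i\<in>{..<j}. X (ts i) \<omega> \<in> C i) \<and> (\<forall>i\<in>{Suc j..n}. X (ts i) \<omega> = xs i)"
  let ?h = "ts (Suc j) - ts j"
  let ?rest = "\<Prod>i\<in>{Suc j..<n}. P (ts (Suc i) - ts i) (xs i) (xs (Suc i))"
  have nonneg: "ts i \<ge> 0" if "i \<le> n" for i using nonneg_of_incr[OF ts that] .
  have state: "prob {\<omega> \<in> space M. ?Q \<omega> \<and> X (ts j) \<omega> = y}
      = path_weight \<mu> ts C j y * P ?h y (xs (Suc j)) * ?rest" for y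
  proof -
    have "{j..n} = insert j {Suc j..n}" "{j..<n} = insert j {Suc j..<n}" using Suc.prems by auto
    then show ?thesis using Suc.IH[of "xs(j := y)"] Suc.prems by (simp add: conj_ac mult.assoc)
  qed
  have "prob {\<omega> \<in> space M. (\<forall>i\<in>{..<Suc j}. X (ts i) \<omega> \<in> C i) \<and> (\<forall>i\<in>{Suc j..n}. X (ts i) \<omega> = xs i)}
      = prob {\<omega> \<in> space M. ?Q \<omega> \<and> X (ts j) \<omega> \<in> C j}"
    by (simp add: lessThan_Suc conj_ac)
  also have "\<dots> = (\<Sum>y\<in>C j. prob {\<omega> \<in> space M. ?Q \<omega> \<and> X (ts j) \<omega> = y})"
    using Suc.prems nonneg C
    by (intro prob_sum_states sets.sets_Collect_conj finite_times_event) auto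
  finally show ?case unfolding state by (simp add: sum_distrib_right)
qed

lemma prob_path:
  assumes ts: "ts 0 = 0" "\<And>i. i < n \<Longrightarrow> ts i \<le> ts (Suc i)" and C: "\<And>i. C i \<subseteq> Om"
  shows "prob {\<omega> \<in> space M. \<forall>i\<in>{..n}. X (ts i) \<omega> \<in> C i} = (\<Sum>y\<in>C n. path_weight \<mu> ts C n y)"
proof -
  have nonneg: "ts i \<ge> 0" if "i \<le> n" for i using nonneg_of_incr[OF ts that] .
  have "prob {\<omega> \<in> space M. \<forall>i\<in>{..n}. X (ts i) \<omega> \<in> C i}
      = prob {\<omega> \<in> space M. (\<forall>i\<in>{..<n}. X (ts i) \<omega> \<in> C i) \<and> X (ts n) \<omega> \<in> C n}"
    by (simp add: lessThan_Suc_atMost[symmetric] lessThan_Suc conj_ac)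
  also have "\<dots> = (\<Sum>y\<in>C n. prob {\<omega> \<in> space M. (\<forall>i\<in>{..<n}. X (ts i) \<omega> \<in> C i) \<and> X (ts n) \<omega> = y})"
    using nonneg C by (intro prob_sum_states finite_times_event) auto
  also have "\<dots> = (\<Sum>y\<in>C n. path_weight \<mu> ts C n y)"
    using prob_path_prefix[OF ts C order_refl, where xs = "\<lambda>_. y" for y] by simp
  finally show ?thesis .
qed

end

locale stationary_ctmc = stationary_chain Om R \<nu> + ctmc Om R M \<nu> X
  for Om :: "'a set" and R and \<nu> and M :: "'b measure" and X
begin

lemma prob_two_times:
  assumes "s \<ge> 0" "h \<ge> 0" "C \<subseteq> Om" "D \<subseteq> Om"
  shows "prob {\<omega> \<in> space M. X s \<omega> \<in> C \<and> X (s + h) \<omega> \<in> D} = (\<Sum>x\<in>C. \<nu> x * (\<Sum>y\<in>D. P h x y))"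
proof -
  define ts :: "nat \<Rightarrow> real" where "ts i = (if i = 0 then 0 else if i = 1 then s else s + h)" for i
  define E where "E i = (if i = 0 then Om else if i = 1 then C else D)" for i :: nat
  have "{\<omega> \<in> space M. X s \<omega> \<in> C \<and> X (s + h) \<omega> \<in> D} = {\<omega> \<in> space M. \<forall>i\<in>{..2}. X (ts i) \<omega> \<in> E i}"
    using X_in_Om by (auto simp: ts_def E_def numeral_2_eq_2 atMost_Suc)
  also have "prob \<dots> = (\<Sum>y\<in>E 2. path_weight \<nu> ts E 2 y)"
    by (rule prob_path) (use assms in \<open>auto simp: ts_def E_def\<close>)
  also have "\<dots> = (\<Sum>y\<in>D. \<Sum>x\<in>C. \<nu> x * P h x y)"
    using assms(3,4) nu_trans_fun by (auto simp: numeral_2_eq_2 ts_def E_def intro!: sum.cong)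
  also have "\<dots> = (\<Sum>x\<in>C. \<nu> x * (\<Sum>y\<in>D. P h x y))"
    by (subst sum.swap) (simp add: sum_distrib_left)
  finally show ?thesis .
qed

end

section \<open>Avoiding a set\<close>

definition right_dense :: "real set \<Rightarrow> real set \<Rightarrow> bool" where
  "right_dense D I \<longleftrightarrow> D \<subseteq> I \<and> (\<forall>t\<in>I. \<forall>e>0. \<exists>s\<in>D. t \<le> s \<and> s < t + e)"

lemma right_dense_Un: "right_dense D I \<Longrightarrow> right_dense D' I' \<Longrightarrow> right_dense (D \<union> D') (I \<union> I')"
  unfolding right_dense_def by blast

lemma right_dense_greaterThan: "right_dense {a<..} {a..}"
  unfolding right_dense_def
proof (intro conjI ballI allI impI)
  fix t e :: real
  assume "t \<in> {a..}" "e > 0"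
  then show "\<exists>s\<in>{a<..}. t \<le> s \<and> s < t + e" by (intro bexI[of _ "t + e / 2"]) auto
qed auto

lemma right_dense_greaterThanLessThan: "right_dense {a<..<b} {a..<b}"
  unfolding right_dense_def
proof (intro conjI ballI allI impI)
  fix t e :: real
  assume t: "t \<in> {a..<b}" and "e > 0"
  define d where "d = min e (b - t) / 2"
  have "0 < d" "d < e" "d < b - t" using t \<open>e > 0\<close> by (auto simp: d_def)
  then show "\<exists>s\<in>{a<..<b}. t \<le> s \<and> s < t + e" using t by (intro bexI[of _ "t + d"]) auto
qed auto

definition dyadic_grid :: "real \<Rightarrow> real \<Rightarrow> nat \<Rightarrow> real set" where
  "dyadic_grid a b n = (\<lambda>i. a + (b - a) * real i / 2 ^ n) ` {..2 ^ n}"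

lemma finite_dyadic_grid: "finite (dyadic_grid a b n)"
  by (simp add: dyadic_grid_def)

lemma left_endpoint_in_dyadic_grid: "a \<in> dyadic_grid a b n"
  unfolding dyadic_grid_def by (intro image_eqI[of _ _ 0]) auto

lemma dyadic_grid_subset:
  assumes "a \<le> b"
  shows "dyadic_grid a b n \<subseteq> {a..b}"
proof
  fix t assume "t \<in> dyadic_grid a b n"
  then obtain i where i: "i \<le> 2 ^ n" and t: "t = a + (b - a) * (real i / 2 ^ n)"
    unfolding dyadic_grid_def by auto
  have "real i / 2 ^ n \<le> 1" using i by simp
  then have "(b - a) * (real i / 2 ^ n) \<le> b - a" using assms by (intro mult_left_le) auto
  then show "t \<in> {a..b}" using assms t by simp
qed

lemma incseq_dyadic_grid: "incseq (dyadic_grid a b)"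
proof (rule incseq_SucI, rule subsetI)
  fix n t assume "t \<in> dyadic_grid a b n"
  then obtain i where "i \<le> 2 ^ n" "t = a + (b - a) * real i / 2 ^ n"
    unfolding dyadic_grid_def by auto
  then show "t \<in> dyadic_grid a b (Suc n)"
    unfolding dyadic_grid_def by (intro image_eqI[of _ _ "2 * i"]) auto
qed

lemma right_dense_dyadic_grid:
  assumes "a \<le> b"
  shows "right_dense (\<Union>n. dyadic_grid a b n) {a..b}"
  unfolding right_dense_def
proof (intro conjI ballI allI impI)
  show "(\<Union>n. dyadic_grid a b n) \<subseteq> {a..b}" using dyadic_grid_subset[OF assms] by blast
  fix t e :: real assume t: "t \<in> {a..b}" and e: "e > 0"
  show "\<exists>s\<in>\<Union>n. dyadic_grid a b n. t \<le> s \<and> s < t + e"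
  proof (cases "a = b")
    case True
    then show ?thesis using t e left_endpoint_in_dyadic_grid by (intro bexI[of _ a]) auto
  next
    case False
    then have ab: "a < b" using assms by simp
    obtain n where "(b - a) / e < 2 ^ n" using real_arch_pow[of 2 "(b - a) / e"] by auto
    then have mesh: "(b - a) / 2 ^ n < e" using e by (simp add: field_simps)
    define u where "u = (t - a) * 2 ^ n / (b - a)"
    define i where "i = nat \<lceil>u\<rceil>"
    have u: "0 \<le> u" "u \<le> 2 ^ n" using t ab by (auto simp: u_def field_simps)
    then have i: "u \<le> real i" "real i < u + 1" unfolding i_def by linarith+
    have "\<lceil>u\<rceil> \<le> 2 ^ n" using u(2) by (simp add: ceiling_le_iff)
    then have "i \<le> 2 ^ n" unfolding i_def by (simp add: nat_le_iff)
    moreover have "t = a + (b - a) * u / 2 ^ n" using ab by (simp add: u_def)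
    moreover have "(b - a) * u / 2 ^ n \<le> (b - a) * real i / 2 ^ n"
      using i ab by (intro divide_right_mono mult_left_mono) auto
    moreover have "(b - a) * real i / 2 ^ n < (b - a) * (u + 1) / 2 ^ n"
      using i ab by (intro divide_strict_right_mono mult_strict_left_mono) auto
    moreover have "(b - a) * (u + 1) / 2 ^ n = (b - a) * u / 2 ^ n + (b - a) / 2 ^ n"
      by (simp add: distrib_left add_divide_distrib)
    ultimately show ?thesis
      using mesh unfolding dyadic_grid_def
      by (intro bexI[of _ "a + (b - a) * real i / 2 ^ n"] UN_I[of n]) auto
  qed
qed

context ctmc
begin

definition avoids :: "'a set \<Rightarrow> real set \<Rightarrow> 'b set" where
  "avoids A I = {\<omega> \<in> space M. \<forall>t\<in>I. X t \<omega> \<notin> A}"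

lemma avoids_Un: "avoids A (I \<union> J) = avoids A I \<inter> avoids A J"
  by (auto simp: avoids_def)

lemma avoids_antimono: "I \<subseteq> J \<Longrightarrow> avoids A J \<subseteq> avoids A I"
  by (auto simp: avoids_def)

lemma avoids_UN: "avoids A (\<Union>n. I n) = (\<Inter>n. avoids A (I n))"
  by (auto simp: avoids_def)

lemma avoids_finite_event: "finite I \<Longrightarrow> I \<subseteq> {0..} \<Longrightarrow> avoids A I \<in> events"
  unfolding avoids_def by (rule finite_times_event) auto

lemma avoids_right_dense:
  assumes "right_dense D I" "I \<subseteq> {0..}"
  shows "avoids A D = avoids A I"
proof (rule antisym)
  show "avoids A I \<subseteq> avoids A D" using assms(1)
    by (intro avoids_antimono) (simp add: right_dense_def)
  show "avoids A D \<subseteq> avoids A I"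
  proof
    fix \<omega> assume \<omega>: "\<omega> \<in> avoids A D"
    have "X t \<omega> \<notin> A" if "t \<in> I" for t
    proof -
      have "\<omega> \<in> space M" "t \<ge> 0" using \<omega> assms(2) that by (auto simp: avoids_def)
      then obtain e where e: "e > 0" "\<And>s. t \<le> s \<Longrightarrow> s < t + e \<Longrightarrow> X s \<omega> = X t \<omega>"
        using X_right_continuous by blast
      obtain s where "s \<in> D" "t \<le> s" "s < t + e"
        using assms(1) \<open>t \<in> I\<close> e(1) unfolding right_dense_def by blast
      moreover from this have "X s \<omega> \<notin> A" using \<omega> by (simp add: avoids_def)
      ultimately show ?thesis using e(2)[of s] by simp
    qed
    then show "\<omega> \<in> avoids A I" using \<omega> by (simp add: avoids_def)
  qed
qed

lemma prob_avoids_tendsto: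
  assumes "incseq D" "\<And>n. finite (D n)" "right_dense (\<Union>n. D n) I" "I \<subseteq> {0..}"
  shows "(\<lambda>n. prob (avoids A (D n))) \<longlonglongrightarrow> prob (avoids A I)"
proof -
  have "(\<Union>n. D n) \<subseteq> {0..}" using assms(3,4) unfolding right_dense_def by blast
  then have "avoids A (D n) \<in> events" for n
    by (intro avoids_finite_event assms(2)) auto
  moreover have "decseq (\<lambda>n. avoids A (D n))"
    using assms(1) by (auto simp: incseq_def decseq_def intro!: avoids_antimono)
  ultimately have "(\<lambda>n. prob (avoids A (D n))) \<longlonglongrightarrow> prob (\<Inter>n. avoids A (D n))"
    by (intro finite_Lim_measure_decseq) auto
  then show ?thesis using avoids_right_dense[OF assms(3,4)] by (simp add: avoids_UN)
qed

lemma avoids_Icc_event: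
  assumes "0 \<le> a"
  shows "avoids A {a..b} \<in> events"
proof (cases "a \<le> b")
  case True
  have "avoids A (dyadic_grid a b n) \<in> events" for n
    using dyadic_grid_subset[OF True] assms
    by (intro avoids_finite_event finite_dyadic_grid) force
  then have "(\<Inter>n. avoids A (dyadic_grid a b n)) \<in> events" by (intro sets.countable_INT) auto
  also have "(\<Inter>n. avoids A (dyadic_grid a b n)) = avoids A {a..b}"
    using avoids_right_dense[OF right_dense_dyadic_grid[OF True]] assms by (simp add: avoids_UN)
  finally show ?thesis .
qed (simp add: avoids_def)

lemma prob_avoids_Icc_tendsto:
  assumes "0 \<le> a" "a \<le> b"
  shows "(\<lambda>n. prob (avoids A (dyadic_grid a b n))) \<longlonglongrightarrow> prob (avoids A {a..b})"
  using assms
  by (intro prob_avoids_tendsto incseq_dyadic_grid finite_dyadic_grid right_dense_dyadic_grid) auto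

lemma prob_avoids_two_Icc_tendsto:
  assumes "0 \<le> a" "a \<le> b" "0 \<le> c" "c \<le> d"
  shows "(\<lambda>n. prob (avoids A (dyadic_grid a b n \<union> dyadic_grid c d n)))
    \<longlonglongrightarrow> prob (avoids A ({a..b} \<union> {c..d}))"
proof (rule prob_avoids_tendsto)
  show "incseq (\<lambda>n. dyadic_grid a b n \<union> dyadic_grid c d n)"
    using incseq_dyadic_grid[of a b] incseq_dyadic_grid[of c d] unfolding incseq_def by blast
  show "right_dense (\<Union>n. dyadic_grid a b n \<union> dyadic_grid c d n) ({a..b} \<union> {c..d})"
    using right_dense_Un[OF right_dense_dyadic_grid right_dense_dyadic_grid] assms
    by (simp add: UN_Un_distrib)
qed (use assms in \<open>auto simp: finite_dyadic_grid\<close>)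

lemma prob_avoids_times:
  assumes "ts 0 = 0" "\<And>i. i < n \<Longrightarrow> ts i \<le> ts (Suc i)"
  shows "prob (avoids A (ts ` {..n})) = (\<Sum>y\<in>Om - A. path_weight \<mu> ts (\<lambda>_. Om - A) n y)"
proof -
  have "avoids A (ts ` {..n}) = {\<omega> \<in> space M. \<forall>i\<in>{..n}. X (ts i) \<omega> \<in> Om - A}"
    using X_in_Om nonneg_of_incr[OF assms] by (auto simp: avoids_def)
  then show ?thesis using prob_path[of ts n "\<lambda>_. Om - A"] assms by simp
qed

end

context stationary_ctmc
begin

lemma prob_avoids_times_decouple:
  assumes "ts 0 = 0" and incr: "\<And>i. i < Suc k + m \<Longrightarrow> ts i \<le> ts (Suc i)"
    and "mixed (ts (Suc k) - ts k) D"
  shows "\<bar>prob (avoids A (ts ` {..Suc k + m}))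
      - prob (avoids A (ts ` {..k})) * prob (avoids A ((\<lambda>i. ts (Suc k + i) - ts (Suc k)) ` {..m}))\<bar>
    \<le> prob (avoids A (ts ` {..k})) * D"
proof -
  let ?C = "\<lambda>_. Om - A"
  let ?w = "path_weight \<nu> ts ?C (Suc k + m)"
  let ?v = "path_weight \<nu> (\<lambda>i. ts (Suc k + i) - ts (Suc k)) ?C m"
  define F where "F = (\<Sum>y\<in>Om - A. path_weight \<nu> ts ?C k y)"
  have "\<bar>(\<Sum>y\<in>Om - A. ?w y) - F * (\<Sum>y\<in>Om - A. ?v y)\<bar> = \<bar>\<Sum>y\<in>Om - A. ?w y - F * ?v y\<bar>"
    by (simp add: sum_subtractf sum_distrib_left)
  also have "\<dots> \<le> (\<Sum>y\<in>Om - A. \<bar>?w y - F * ?v y\<bar>)" by (rule sum_abs)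
  also have "\<dots> \<le> (\<Sum>y\<in>Om. \<bar>?w y - F * ?v y\<bar>)"
    using finite_states by (intro sum_mono2) auto
  also have "\<dots> \<le> F * D"
    unfolding F_def using nu_nonneg
    by (intro path_weight_decouple[where C = ?C, OF _ incr _ assms(3) order_refl]) auto
  finally show ?thesis
    using prob_avoids_times[of ts "Suc k + m" A] prob_avoids_times[of ts k A]
      prob_avoids_times[of "\<lambda>i. ts (Suc k + i) - ts (Suc k)" m A] assms
    by (simp add: F_def)
qed

lemma prob_avoids_grids_decouple:
  assumes "t \<ge> 0" "s \<ge> 0" "mixed S D"
  shows "\<bar>prob (avoids A (dyadic_grid 0 t n \<union> dyadic_grid (t + S) (t + S + s) n))
      - prob (avoids A (dyadic_grid 0 t n)) * prob (avoids A (dyadic_grid 0 s n))\<bar>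
    \<le> prob (avoids A (dyadic_grid 0 t n)) * D"
proof -
  define k :: nat where "k = 2 ^ n"
  have k: "k > 0" "(2 :: real) ^ n = real k" by (auto simp: k_def)
  have S: "S \<ge> 0" using assms(3) by (simp add: mixed_def)
  define ts where
    "ts i = (if i \<le> k then t * real i / k else t + S + s * real (i - Suc k) / k)" for i
  have gap: "ts (Suc k) - ts k = S" and start: "ts 0 = 0" using k by (auto simp: ts_def)
  have "ts i \<le> ts (Suc i)" for i
  proof (cases i k rule: linorder_cases)
    case equal
    then show ?thesis using gap S by simp
  qed (use assms in \<open>auto simp: ts_def Suc_diff_le intro!: divide_right_mono mult_left_mono\<close>)
  note decouple = prob_avoids_times_decouple[of ts k k D A, unfolded gap, OF start this assms(3)]
  have left: "ts ` {..k} = dyadic_grid 0 t n"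
    unfolding dyadic_grid_def k_def[symmetric] k(2) by (intro image_cong) (auto simp: ts_def)
  have shifted: "(\<lambda>i. ts (Suc k + i) - ts (Suc k)) ` {..k} = dyadic_grid 0 s n"
    unfolding dyadic_grid_def k_def[symmetric] k(2) by (intro image_cong) (auto simp: ts_def)
  have "{..Suc k + k} = {..k} \<union> (+) (Suc k) ` {..k}"
    by (auto simp: image_iff Bex_def) presburger
  then have "ts ` {..Suc k + k} = ts ` {..k} \<union> (\<lambda>i. ts (Suc k + i)) ` {..k}"
    by (simp add: image_Un image_image)
  also have "(\<lambda>i. ts (Suc k + i)) ` {..k} = dyadic_grid (t + S) (t + S + s) n"
    unfolding dyadic_grid_def k_def[symmetric] k(2) by (intro image_cong) (auto simp: ts_def)
  finally show ?thesis using decouple unfolding left shifted by simp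
qed

lemma prob_avoids_decouple:
  assumes "t \<ge> 0" "s \<ge> 0" "mixed S D"
  shows "\<bar>prob (avoids A ({0..t} \<union> {t + S..t + S + s}))
      - prob (avoids A {0..t}) * prob (avoids A {0..s})\<bar> \<le> prob (avoids A {0..t}) * D"
proof (rule LIMSEQ_le)
  have S: "S \<ge> 0" using assms(3) by (simp add: mixed_def)
  show "(\<lambda>n. \<bar>prob (avoids A (dyadic_grid 0 t n \<union> dyadic_grid (t + S) (t + S + s) n))
      - prob (avoids A (dyadic_grid 0 t n)) * prob (avoids A (dyadic_grid 0 s n))\<bar>)
    \<longlonglongrightarrow> \<bar>prob (avoids A ({0..t} \<union> {t + S..t + S + s}))
      - prob (avoids A {0..t}) * prob (avoids A {0..s})\<bar>"
    using assms S by (intro tendsto_intros prob_avoids_Icc_tendsto prob_avoids_two_Icc_tendsto) auto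
  show "(\<lambda>n. prob (avoids A (dyadic_grid 0 t n)) * D) \<longlonglongrightarrow> prob (avoids A {0..t}) * D"
    using assms by (intro tendsto_intros prob_avoids_Icc_tendsto) auto
qed (use prob_avoids_grids_decouple[OF assms] in blast)

section \<open>The entrance rate\<close>

lemma prob_enter_grid_le:
  assumes "t \<ge> 0" "h \<ge> 0" "A \<subseteq> Om"
  shows "prob (avoids A {t} - avoids A (dyadic_grid t (t + h) n))
    \<le> 2 ^ n * (\<Sum>x\<in>Om - A. \<nu> x * (\<Sum>y\<in>A. P (h / 2 ^ n) x y))"
proof -
  define d where "d = h / 2 ^ n"
  have d: "d \<ge> 0" using assms by (simp add: d_def)
  define jump where
    "jump i = {\<omega> \<in> space M. X (t + real i * d) \<omega> \<in> Om - A \<and> X (t + real i * d + d) \<omega> \<in> A}" for i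
  have jump: "jump i \<in> events" for i
    unfolding jump_def using assms d by (intro sets.sets_Collect_conj state_event) auto
  have "avoids A {t} - avoids A (dyadic_grid t (t + h) n) \<subseteq> (\<Union>i\<in>{..<2 ^ n}. jump i)"
  proof
    fix \<omega> assume \<omega>: "\<omega> \<in> avoids A {t} - avoids A (dyadic_grid t (t + h) n)"
    then obtain j where "j \<le> 2 ^ n" "X (t + real j * d) \<omega> \<in> A"
      unfolding avoids_def dyadic_grid_def d_def by (auto simp: mult.commute)
    moreover have "X (t + real 0 * d) \<omega> \<notin> A" using \<omega> by (simp add: avoids_def)
    ultimately obtain i where "i < j" "X (t + real i * d) \<omega> \<notin> A" "X (t + real (Suc i) * d) \<omega> \<in> A"
      using ex_least_nat_less[of "\<lambda>i. X (t + real i * d) \<omega> \<in> A" j] by blast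
    then have "\<omega> \<in> jump i"
      using \<omega> assms d X_in_Om[of \<omega> "t + real i * d"]
      by (auto simp: jump_def avoids_def algebra_simps)
    then show "\<omega> \<in> (\<Union>i\<in>{..<2 ^ n}. jump i)" using \<open>i < j\<close> \<open>j \<le> 2 ^ n\<close> by auto
  qed
  then have "prob (avoids A {t} - avoids A (dyadic_grid t (t + h) n))
      \<le> prob (\<Union>i\<in>{..<2 ^ n}. jump i)"
    using jump by (intro finite_measure_mono) auto
  also have "\<dots> \<le> (\<Sum>i<2 ^ n. prob (jump i))"
    using jump by (intro finite_measure_subadditive_finite) auto
  also have "\<dots> = (\<Sum>i<(2::nat) ^ n. \<Sum>x\<in>Om - A. \<nu> x * (\<Sum>y\<in>A. P d x y))"
    unfolding jump_def using assms d by (intro sum.cong refl prob_two_times) auto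
  finally show ?thesis by (simp add: d_def)
qed

lemma entrance_rate_tendsto:
  assumes "h > 0" "A \<subseteq> Om"
  shows "(\<lambda>n. 2 ^ n * (\<Sum>x\<in>Om - A. \<nu> x * (\<Sum>y\<in>A. P (h / 2 ^ n) x y)))
    \<longlonglongrightarrow> (\<Sum>x\<in>Om - A. \<nu> x * (\<Sum>y\<in>A. R x y)) * h"
proof -
  have "(\<lambda>n. h * (1 / 2) ^ n) \<longlonglongrightarrow> 0"
    by (intro tendsto_mult_right_zero LIMSEQ_power_zero) simp
  then have "filterlim (\<lambda>n. h / 2 ^ n) (at 0) sequentially"
    using assms(1) by (simp add: filterlim_at power_divide)
  then have "(\<lambda>n. P (h / 2 ^ n) x y / (h / 2 ^ n)) \<longlonglongrightarrow> R x y" if "x \<in> Om - A" "y \<in> A" for x y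
    using that assms(2) by (intro filterlim_compose[OF trans_fun_jump_rate]) auto
  then have "(\<lambda>n. (\<Sum>x\<in>Om - A. \<nu> x * (\<Sum>y\<in>A. P (h / 2 ^ n) x y / (h / 2 ^ n))) * h)
      \<longlonglongrightarrow> (\<Sum>x\<in>Om - A. \<nu> x * (\<Sum>y\<in>A. R x y)) * h"
    by (intro tendsto_intros) auto
  moreover have "(\<Sum>x\<in>Om - A. \<nu> x * (\<Sum>y\<in>A. P (h / 2 ^ n) x y / (h / 2 ^ n))) * h
      = 2 ^ n * (\<Sum>x\<in>Om - A. \<nu> x * (\<Sum>y\<in>A. P (h / 2 ^ n) x y))" for n
    unfolding sum_distrib_left sum_distrib_right using assms(1)
    by (intro sum.cong refl) (simp add: field_simps)
  ultimately show ?thesis by simp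
qed

lemma entrance_rate_le_rate_into:
  assumes "A \<subseteq> Om"
  shows "(\<Sum>x\<in>Om - A. \<nu> x * (\<Sum>y\<in>A. R x y)) \<le> rate_into Om R \<nu> A"
proof (cases "Om - A = {}")
  case True
  then show ?thesis by (simp only: rate_into_def sum.empty mult_zero_right order_refl)
next
  case False
  have "R x y \<ge> 0" if "x \<in> Om - A" "y \<in> A" for x y
    using that assms nonneg_rates unfolding nonneg_rates_def by (metis DiffD1 DiffD2 subsetD)
  then have "0 \<le> (\<Sum>x\<in>Om - A. \<nu> x * (\<Sum>y\<in>A. R x y))"
    using nu_nonneg by (intro sum_nonneg mult_nonneg_nonneg) auto
  moreover
  have "(\<Sum>x\<in>Om - A. \<nu> x) \<le> (\<Sum>x\<in>Om. \<nu> x)"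
    using finite_states nu_nonneg by (intro sum_mono2) auto
  moreover have "0 < (\<Sum>x\<in>Om - A. \<nu> x)"
    using False finite_states nu_pos by (intro sum_pos) auto
  ultimately show ?thesis by (simp add: rate_into_def nu_sum pos_le_divide_eq mult_left_le)
qed

lemma prob_enter_le:
  assumes "t \<ge> 0" "h \<ge> 0" "A \<subseteq> Om"
  shows "prob (avoids A {t} - avoids A {t..t + h}) \<le> rate_into Om R \<nu> A * h"
proof (cases "h = 0")
  case False
  have "avoids A {t} \<in> events" using assms(1) by (intro avoids_finite_event) auto
  then have leave: "prob (avoids A {t} - avoids A I) = prob (avoids A {t}) - prob (avoids A I)"
    if "t \<in> I" "avoids A I \<in> events" for I
    using that by (intro finite_measure_Diff avoids_antimono) auto
  have "avoids A (dyadic_grid t (t + h) n) \<in> events" for n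
    using dyadic_grid_subset[of t "t + h" n] assms
    by (intro avoids_finite_event finite_dyadic_grid) auto
  then have "(\<lambda>n. prob (avoids A {t} - avoids A (dyadic_grid t (t + h) n)))
      \<longlonglongrightarrow> prob (avoids A {t} - avoids A {t..t + h})"
    using assms leave left_endpoint_in_dyadic_grid avoids_Icc_event
    by (auto intro!: tendsto_diff prob_avoids_Icc_tendsto)
  moreover have "(\<lambda>n. 2 ^ n * (\<Sum>x\<in>Om - A. \<nu> x * (\<Sum>y\<in>A. P (h / 2 ^ n) x y)))
      \<longlonglongrightarrow> (\<Sum>x\<in>Om - A. \<nu> x * (\<Sum>y\<in>A. R x y)) * h"
    using False assms by (intro entrance_rate_tendsto) auto
  ultimately have "prob (avoids A {t} - avoids A {t..t + h}) \<le> (\<Sum>x\<in>Om - A. \<nu> x * (\<Sum>y\<in>A. R x y)) * h"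
    using prob_enter_grid_le[OF assms] by (intro LIMSEQ_le) auto
  also have "\<dots> \<le> rate_into Om R \<nu> A * h"
    using assms entrance_rate_le_rate_into by (intro mult_right_mono) auto
  finally show ?thesis .
qed simp

end

section \<open>Convergence of antitone functions\<close>

lemma antimono_tendsto_of_dense:
  fixes g :: "'i \<Rightarrow> real \<Rightarrow> real" and h :: "real \<Rightarrow> real"
  assumes antimono: "\<And>i. antimono_on {l<..} (g i)"
    and D_dense: "\<And>a b. l < a \<Longrightarrow> a < b \<Longrightarrow> \<exists>d\<in>D. a < d \<and> d < b"
    and lim: "\<And>d. d \<in> D \<Longrightarrow> ((\<lambda>i. g i d) \<longlongrightarrow> h d) F"
    and cont: "isCont h x" and "l < x" and y: "(y \<longlongrightarrow> x) F"
  shows "((\<lambda>i. g i (y i)) \<longlongrightarrow> h x) F"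
proof (rule order_tendstoI)
  fix a assume "a < h x"
  then have "eventually (\<lambda>z. a < h z) (at_right x)"
    using cont unfolding isCont_def filterlim_at_split by (intro order_tendstoD) auto
  then obtain b where "x < b" and above: "\<And>z. x < z \<Longrightarrow> z < b \<Longrightarrow> a < h z"
    unfolding eventually_at_right_field by blast
  then obtain d where d: "d \<in> D" "x < d" "d < b" using D_dense[of x b] \<open>l < x\<close> by blast
  have "eventually (\<lambda>i. a < g i d) F" using lim[OF d(1)] above[OF d(2,3)] by (rule order_tendstoD)
  moreover have "eventually (\<lambda>i. y i < d) F" using y d(2) by (rule order_tendstoD)
  moreover have "eventually (\<lambda>i. l < y i) F" using y \<open>l < x\<close> by (rule order_tendstoD)
  ultimately show "eventually (\<lambda>i. a < g i (y i)) F"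
  proof eventually_elim
    case (elim i)
    then show ?case using monotone_onD[OF antimono, of "y i" d i] by simp
  qed
next
  fix a assume "h x < a"
  then have "eventually (\<lambda>z. h z < a) (at_left x)"
    using cont unfolding isCont_def filterlim_at_split by (intro order_tendstoD) auto
  then obtain b where "b < x" and below: "\<And>z. b < z \<Longrightarrow> z < x \<Longrightarrow> h z < a"
    unfolding eventually_at_left_field by blast
  obtain c where c: "max b l < c" "c < x" using \<open>b < x\<close> \<open>l < x\<close> dense[of "max b l" x] by auto
  then obtain d where d: "d \<in> D" "c < d" "d < x" using D_dense[of c x] by auto
  have "eventually (\<lambda>i. g i d < a) F" using lim[OF d(1)] below[of d] c d
    by (intro order_tendstoD) auto
  moreover have "eventually (\<lambda>i. d < y i) F" using y d(3) by (rule order_tendstoD)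
  ultimately show "eventually (\<lambda>i. g i (y i) < a) F"
  proof eventually_elim
    case (elim i)
    then show ?case using monotone_onD[OF antimono, of d "y i" i] c d by simp
  qed
qed

context
  fixes g :: "'i \<Rightarrow> real \<Rightarrow> real" and F :: "'i filter"
  assumes bounds: "\<And>i u. u > 0 \<Longrightarrow> 0 \<le> g i u \<and> g i u \<le> 1"
    and almost_multiplicative:
      "\<And>u v. u > 0 \<Longrightarrow> v > 0 \<Longrightarrow> ((\<lambda>i. g i (u + v) - g i u * g i v) \<longlongrightarrow> 0) F"
begin

lemma almost_multiplicative_power:
  assumes "u > 0" "m > 0"
  shows "((\<lambda>i. g i (real m * u) - g i u ^ m) \<longlongrightarrow> 0) F"
  using assms(2)
proof (induction m rule: nat_induct_non_zero)
  case (Suc m)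
  have "((\<lambda>i. g i u * (g i (real m * u) - g i u ^ m)) \<longlongrightarrow> 0) F"
  proof (rule Lim_null_comparison[OF always_eventually])
    show "\<forall>i. norm (g i u * (g i (real m * u) - g i u ^ m)) \<le> \<bar>g i (real m * u) - g i u ^ m\<bar>"
      using bounds[OF assms(1)] by (auto simp: abs_mult intro!: mult_left_le_one_le)
    show "((\<lambda>i. \<bar>g i (real m * u) - g i u ^ m\<bar>) \<longlongrightarrow> 0) F"
      using Suc.IH by (rule tendsto_rabs_zero)
  qed
  moreover have "((\<lambda>i. g i (u + real m * u) - g i u * g i (real m * u)) \<longlongrightarrow> 0) F"
    using Suc.hyps assms(1) by (intro almost_multiplicative) auto
  ultimately have "((\<lambda>i. (g i (u + real m * u) - g i u * g i (real m * u))
      + g i u * (g i (real m * u) - g i u ^ m)) \<longlongrightarrow> 0 + 0) F"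
    by (intro tendsto_add)
  then show ?case by (simp add: algebra_simps)
qed simp

lemma almost_multiplicative_tendsto_exp_rational:
  assumes one: "((\<lambda>i. g i 1) \<longlongrightarrow> exp (- 1)) F" and "m > 0" "k > 0"
  shows "((\<lambda>i. g i (real m / real k)) \<longlongrightarrow> exp (- (real m / real k))) F"
proof -
  let ?u = "1 / real k"
  have "((\<lambda>i. g i 1 - (g i (real k * ?u) - g i ?u ^ k)) \<longlongrightarrow> exp (- 1) - 0) F"
    using \<open>k > 0\<close> by (intro tendsto_diff one almost_multiplicative_power) auto
  then have "((\<lambda>i. root k (g i ?u ^ k)) \<longlongrightarrow> root k (exp (- ?u) ^ k)) F"
    using \<open>k > 0\<close> by (intro tendsto_real_root) (simp add: exp_of_nat_mult[symmetric])
  then have "((\<lambda>i. g i ?u) \<longlongrightarrow> exp (- ?u)) F"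
    using bounds[of ?u] \<open>k > 0\<close> by (simp add: real_root_power_cancel)
  then have "((\<lambda>i. (g i (real m * ?u) - g i ?u ^ m) + g i ?u ^ m) \<longlongrightarrow> 0 + exp (- ?u) ^ m) F"
    using \<open>k > 0\<close> \<open>m > 0\<close> by (intro tendsto_add tendsto_power almost_multiplicative_power) auto
  then show ?thesis by (simp add: exp_of_nat_mult[symmetric])
qed

text \<open>The limit at 1 determines the limits at the positive rationals; monotonicity does the rest.\<close>

lemma almost_multiplicative_tendsto_exp:
  assumes "\<And>i. antimono_on {0<..} (g i)" "((\<lambda>i. g i 1) \<longlongrightarrow> exp (- 1)) F" "x > 0" "(y \<longlongrightarrow> x) F"
  shows "((\<lambda>i. g i (y i)) \<longlongrightarrow> exp (- x)) F"
proof (rule antimono_tendsto_of_dense[where g = g and y = y and h = "\<lambda>x. exp (- x)" and l = 0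
      and D = "{q \<in> \<rat>. q > 0}"])
  show "\<exists>q\<in>{q \<in> \<rat>. q > 0}. a < q \<and> q < b" if "0 < a" "a < b" for a b :: real
    using Rats_dense_in_real[OF that(2)] that(1) by force
  show "((\<lambda>i. g i q) \<longlongrightarrow> exp (- q)) F" if q: "q \<in> {q \<in> \<rat>. q > 0}" for q
  proof -
    have "q \<in> \<rat>" "q > 0" using q by auto
    from \<open>q \<in> \<rat>\<close> obtain m k :: nat where k: "k \<noteq> 0" and m: "\<bar>q\<bar> = real m / real k"
      by (rule Rats_abs_nat_div_natE)
    have "q = real m / real k" "m > 0" using m \<open>q > 0\<close> by (auto simp: zero_less_divide_iff)
    then show ?thesis
      using almost_multiplicative_tendsto_exp_rational[OF assms(2), of m k] k by simp
  qed
  show "isCont (\<lambda>x. exp (- x)) x" by (intro continuous_intros)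
qed (use assms in simp_all)

end

section \<open>Lipschitz survival functions\<close>

definition decay_rate :: "real \<Rightarrow> real \<Rightarrow> real" where
  "decay_rate L q = - ln q / L"

text \<open>The survival function of a nonnegative time whose hazard is at most \<open>r\<close>.\<close>

locale survival_function =
  fixes f :: "real \<Rightarrow> real" and r :: real
  assumes antimono: "antimono_on {0..} f"
    and bounds: "t \<ge> 0 \<Longrightarrow> 0 \<le> f t \<and> f t \<le> 1"
    and decrease_le: "t \<ge> 0 \<Longrightarrow> h \<ge> 0 \<Longrightarrow> f t - f (t + h) \<le> r * h"
begin

lemma decreasing: "0 \<le> s \<Longrightarrow> s \<le> t \<Longrightarrow> f t \<le> f s"
  using monotone_onD[OF antimono, of s t] by simp

lemma continuous: "continuous_on {0..} f"
proof (rule lipschitz_on_continuous_on, rule lipschitz_onI)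
  show "0 \<le> r" using decrease_le[of 0 1] decreasing[of 0 1] by simp
  have ordered: "\<bar>f s - f t\<bar> \<le> r * \<bar>s - t\<bar>" if "0 \<le> s" "s \<le> t" for s t
    using decrease_le[of s "t - s"] decreasing[of s t] that by simp
  show "dist (f s) (f t) \<le> r * dist s t" if "s \<in> {0..}" "t \<in> {0..}" for s t
    using that ordered[of s t] ordered[of t s]
    by (cases s t rule: le_cases) (auto simp: dist_real_def abs_minus_commute)
qed

lemma measurable_on_nonneg: "(\<lambda>t. indicator {0..} t * f t) \<in> borel_measurable borel"
  using borel_measurable_continuous_on_indicator[OF _ continuous] by simp

lemma rescale:
  assumes "\<theta> \<ge> 0"
  shows "survival_function (\<lambda>u. f (\<theta> * u)) (r * \<theta>)"
proof
  show "antimono_on {0..} (\<lambda>u. f (\<theta> * u))"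
    using assms by (intro monotone_onI decreasing) (auto intro: mult_left_mono)
  show "f (\<theta> * t) - f (\<theta> * (t + h)) \<le> r * \<theta> * h" if "t \<ge> 0" "h \<ge> 0" for t h
    using decrease_le[of "\<theta> * t" "\<theta> * h"] assms that by (simp add: distrib_left mult.assoc)
qed (use assms bounds in auto)

definition contracting :: "real \<Rightarrow> real \<Rightarrow> bool" where
  "contracting L q \<longleftrightarrow> L > 0 \<and> 0 < q \<and> q < 1 \<and> (\<forall>t\<ge>0. f (t + L) \<le> q * f t)"

lemma contracting_exponential_bound:
  assumes "contracting L q" "t \<ge> 0"
  shows "f t \<le> 1 / q * exp (- t * decay_rate L q)"
proof -
  have L: "L > 0" and q: "0 < q" "q < 1" and step: "\<And>t. t \<ge> 0 \<Longrightarrow> f (t + L) \<le> q * f t"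
    using assms(1) by (auto simp: contracting_def)
  have iterate: "f (real n * L) \<le> q ^ n" for n
  proof (induction n)
    case (Suc n)
    have "f (real n * L + L) \<le> q * f (real n * L)" using L by (intro step) auto
    also have "\<dots> \<le> q * q ^ n" using Suc q by (intro mult_left_mono) auto
    finally show ?case by (simp add: algebra_simps)
  qed (use bounds[of 0] in simp)
  define n where "n = nat \<lfloor>t / L\<rfloor>"
  have "real n = of_int \<lfloor>t / L\<rfloor>" unfolding n_def using assms(2) L by simp
  then have n: "real n \<le> t / L" "t / L < real n + 1" by linarith+
  have "f t \<le> f (real n * L)" using n L by (intro decreasing) (auto simp: field_simps)
  also have "\<dots> \<le> q ^ n" by (rule iterate)
  also have "\<dots> = exp (real n * ln q)" using q by (simp add: exp_of_nat_mult)
  also have "\<dots> \<le> exp ((t / L - 1) * ln q)"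
    using n q by (auto intro!: mult_right_mono_neg)
  also have "\<dots> = exp (- t * decay_rate L q - ln q)" by (simp add: decay_rate_def algebra_simps)
  also have "\<dots> = 1 / q * exp (- t * decay_rate L q)" using q by (simp add: exp_diff)
  finally show ?thesis .
qed

lemma decay_rate_pos: "contracting L q \<Longrightarrow> decay_rate L q > 0"
  by (simp add: contracting_def decay_rate_def ln_less_zero divide_neg_pos)

lemma contracting_exponential_density_bound:
  assumes "contracting L q"
  shows "norm (indicator {0..} t * f t)
    \<le> 1 / (q * decay_rate L q) * exponential_density (decay_rate L q) t"
proof (cases "t \<ge> 0")
  case True
  then show ?thesis
    using contracting_exponential_bound[OF assms True] decay_rate_pos[OF assms] bounds
    by (simp add: exponential_density_def)
qed (simp add: exponential_density_def)

lemma contracting_tendsto_0: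
  assumes "contracting L q"
  shows "(f \<longlongrightarrow> 0) at_top"
proof (rule Lim_null_comparison)
  show "eventually (\<lambda>t. norm (f t) \<le> 1 / q * exp (- t * decay_rate L q)) at_top"
    using eventually_ge_at_top[of 0]
    by eventually_elim (use contracting_exponential_bound[OF assms] bounds in simp)
  have "filterlim (\<lambda>t. - t * decay_rate L q) at_bot at_top"
    using filterlim_at_top_mult_tendsto_pos
      [OF tendsto_const decay_rate_pos[OF assms] filterlim_ident]
    by (simp add: filterlim_uminus_at_bot)
  then show "((\<lambda>t. 1 / q * exp (- t * decay_rate L q)) \<longlongrightarrow> 0) at_top"
    by (intro tendsto_mult_right_zero filterlim_compose[OF exp_at_bot])
qed

definition gap_multiplicative :: "real \<Rightarrow> real \<Rightarrow> bool" where
  "gap_multiplicative S D \<longleftrightarrow> S \<ge> 0 \<and> D \<ge> 0 \<and> (\<forall>t\<ge>0. \<forall>s\<ge>0.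
     f (t + S + s) \<le> f t * (f s + D) \<and> f t * (f s - D) \<le> f (t + S + s) + r * S)"

lemma gap_multiplicative_error:
  assumes "gap_multiplicative S D" "t \<ge> 0" "s \<ge> 0"
  shows "\<bar>f (t + s) - f t * f s\<bar> \<le> D + r * S"
proof -
  have S: "S \<ge> 0" and D: "D \<ge> 0" and "f (t + S + s) \<le> f t * (f s + D)"
    and "f t * (f s - D) \<le> f (t + S + s) + r * S"
    using assms by (auto simp: gap_multiplicative_def)
  moreover from this have "f (t + S + s) \<le> f t * f s + f t * D"
    and "f t * f s - f t * D \<le> f (t + S + s) + r * S"
    by (simp_all add: distrib_left right_diff_distrib)
  moreover have "f t * D \<le> D" using bounds[OF assms(2)] D by (intro mult_left_le_one_le) auto
  moreover have "f (t + s) - f (t + s + S) \<le> r * S" "f (t + s + S) \<le> f (t + s)"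
    using assms S by (auto intro!: decrease_le decreasing)
  moreover have "t + s + S = t + S + s" by simp
  ultimately show ?thesis by (simp only: abs_le_iff) argo
qed

lemma gap_multiplicative_contracting:
  assumes "gap_multiplicative S D" "S \<le> \<theta>" "\<theta> > 0" "f \<theta> + D \<le> q" "0 < q" "q < 1"
  shows "contracting (2 * \<theta>) q"
  unfolding contracting_def
proof (intro conjI allI impI)
  fix t :: real assume t: "t \<ge> 0"
  have "f (t + 2 * \<theta>) \<le> f (t + S + \<theta>)"
    using assms t by (intro decreasing) (auto simp: gap_multiplicative_def)
  also have "\<dots> \<le> f t * (f \<theta> + D)"
    using assms t by (simp add: gap_multiplicative_def)
  also have "\<dots> \<le> f t * q" using assms(4) bounds[OF t] by (intro mult_left_mono) auto
  finally show "f (t + 2 * \<theta>) \<le> q * f t" by (simp add: mult.commute)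
qed (use assms in auto)

lemma exists_level:
  assumes "(f \<longlongrightarrow> 0) at_top" "a > 0"
  shows "\<exists>\<theta>\<ge>0. f \<theta> = min (f 0) a"
proof (cases "f 0 \<le> a")
  case False
  have "eventually (\<lambda>t. f t < a \<and> t \<ge> 0) at_top"
    using assms by (intro eventually_conj order_tendstoD eventually_ge_at_top)
  then obtain b where "f b < a" "b \<ge> 0"
    using eventually_happens'[OF trivial_limit_at_top_linorder] by blast
  then have "\<exists>\<theta>\<ge>0. \<theta> \<le> b \<and> f \<theta> = a"
    using False by (intro IVT2' continuous_on_subset[OF continuous]) auto
  then show ?thesis using False by auto
qed auto

end

lemma has_bochner_integral_exponential_density:
  assumes "l > 0"
  shows "has_bochner_integral lborel (exponential_density l) 1"
  using nn_integral_erlang_ith_moment[OF assms, of 0 0] assms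
  by (intro has_bochner_integral_nn_integral) auto

text \<open>Time is rescaled by \<open>level_time n\<close>, at which \<open>f n\<close> has fallen to \<open>exp (- 1)\<close>; the minimum in
  its definition matters only for the finitely many \<open>n\<close> with \<open>f n 0 < exp (- 1)\<close>.\<close>

locale survival_sequence =
  fixes f :: "nat \<Rightarrow> real \<Rightarrow> real" and r S D :: "nat \<Rightarrow> real"
  assumes survival: "\<And>n. survival_function (f n) (r n)"
    and r_pos: "\<And>n. r n > 0"
    and vanishing: "\<And>n. (f n \<longlongrightarrow> 0) at_top"
    and start: "(\<lambda>n. f n 0) \<longlonglongrightarrow> 1"
    and gap: "\<And>n. survival_function.gap_multiplicative (f n) (r n) (S n) (D n)"
    and D_tendsto: "D \<longlonglongrightarrow> 0"
    and rS_tendsto: "(\<lambda>n. r n * S n) \<longlonglongrightarrow> 0"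
begin

interpretation survival_function "f n" "r n" for n by (rule survival)

definition level_time :: "nat \<Rightarrow> real" where
  "level_time n = (SOME \<theta>. \<theta> \<ge> 0 \<and> f n \<theta> = min (f n 0) (exp (- 1)))"

lemma level_time_nonneg: "level_time n \<ge> 0"
  and f_level_time: "f n (level_time n) = min (f n 0) (exp (- 1))"
  using someI_ex[OF exists_level[OF vanishing, of "exp (- 1)" n]]
  by (simp_all add: level_time_def)

lemma exp_minus_one_le: "exp (- 1) \<le> (1 / 2 :: real)"
  using exp_ge_add_one_self[of "1 :: real"] by (simp add: exp_minus field_simps)

lemma eventually_gap_le_level_time:
  "eventually (\<lambda>n. S n \<le> level_time n \<and> level_time n > 0) sequentially"
proof -
  have "eventually (\<lambda>n. f n 0 > 3 / 4) sequentially" using start by (rule order_tendstoD) simp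
  moreover have "eventually (\<lambda>n. r n * S n < 1 / 4) sequentially" using rS_tendsto
    by (rule order_tendstoD) simp
  ultimately show ?thesis
  proof eventually_elim
    case (elim n)
    have "1 / 4 \<le> f n 0 - f n (level_time n)"
      using elim(1) exp_minus_one_le by (simp add: f_level_time)
    also have "\<dots> \<le> r n * level_time n"
      using decrease_le[of 0 "level_time n" n] level_time_nonneg[of n] by simp
    finally have "r n * S n \<le> r n * level_time n" "0 < r n * level_time n" using elim(2) by auto
    then show ?case using r_pos[of n] by (simp add: zero_less_mult_iff)
  qed
qed

definition rescaled :: "nat \<Rightarrow> real \<Rightarrow> real" where
  "rescaled n u = f n (level_time n * u)"

interpretation rescaled: survival_function "rescaled n" "r n * level_time n" for n
  using rescale[OF level_time_nonneg] by (simp add: rescaled_def[abs_def])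

lemma eventually_rescaled_contracting:
  "eventually (\<lambda>n. rescaled.contracting n 2 (3 / 4)) sequentially"
proof -
  have "eventually (\<lambda>n. D n < 1 / 4) sequentially" using D_tendsto by (rule order_tendstoD) simp
  then show ?thesis
    using eventually_gap_le_level_time
  proof eventually_elim
    case (elim n)
    have "contracting n (2 * level_time n) (3 / 4)"
      using elim exp_minus_one_le
      by (intro gap_multiplicative_contracting[OF gap]) (auto simp: f_level_time min_def)
    then show ?case
      using level_time_nonneg[of n]
      by (simp add: rescaled.contracting_def contracting_def rescaled_def algebra_simps)
  qed
qed

lemma rescaled_almost_multiplicative:
  assumes "u \<ge> 0" "v \<ge> 0"
  shows "(\<lambda>n. rescaled n (u + v) - rescaled n u * rescaled n v) \<longlonglongrightarrow> 0"
proof (rule Lim_null_comparison[OF always_eventually])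
  show "(\<lambda>n. D n + r n * S n) \<longlonglongrightarrow> 0" using tendsto_add[OF D_tendsto rS_tendsto] by simp
  show "\<forall>n. norm (rescaled n (u + v) - rescaled n u * rescaled n v) \<le> D n + r n * S n"
    using gap_multiplicative_error[OF gap] assms level_time_nonneg
    by (simp add: rescaled_def distrib_left)
qed

lemma rescaled_tendsto_exp:
  assumes "x > 0" "y \<longlonglongrightarrow> x"
  shows "(\<lambda>n. rescaled n (y n)) \<longlonglongrightarrow> exp (- x)"
proof (rule almost_multiplicative_tendsto_exp[where g = rescaled])
  show "(\<lambda>n. rescaled n 1) \<longlonglongrightarrow> exp (- 1)"
    using tendsto_min[OF start tendsto_const, of "exp (- 1)"]
    by (simp add: rescaled_def f_level_time min_def)
  show "antimono_on {0<..} (rescaled n)" for n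
    using rescaled.antimono by (rule monotone_on_subset) auto
qed (use assms rescaled.bounds rescaled_almost_multiplicative in auto)

lemma rescaled_integral_tendsto: "(\<lambda>n. LINT u|lborel. indicator {0..} u * rescaled n u) \<longlonglongrightarrow> 1"
proof -
  let ?c = "decay_rate 2 (3 / 4)"
  obtain N where N: "\<And>n. n \<ge> N \<Longrightarrow> rescaled.contracting n 2 (3 / 4)"
    using eventually_rescaled_contracting unfolding eventually_sequentially by blast
  then have c: "?c > 0" using rescaled.decay_rate_pos by blast
  have "(\<lambda>n. LINT u|lborel. indicator {0..} u * rescaled (n + N) u)
      \<longlonglongrightarrow> (LINT u|lborel. exponential_density 1 u)"
  proof (rule integral_dominated_convergence)
    show "integrable lborel (\<lambda>u. 1 / (3 / 4 * ?c) * exponential_density ?c u)"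
      using has_bochner_integral_exponential_density[OF c]
      by (intro integrable_mult_right) (auto simp: has_bochner_integral_iff)
    show "AE u in lborel. norm (indicator {0..} u * rescaled (n + N) u)
        \<le> 1 / (3 / 4 * ?c) * exponential_density ?c u" for n
      using rescaled.contracting_exponential_density_bound[OF N] by simp
    have pointwise: "(\<lambda>n. indicator {0..} u * rescaled (n + N) u) \<longlonglongrightarrow> exponential_density 1 u"
      if "u \<noteq> 0" for u
      using LIMSEQ_ignore_initial_segment[OF rescaled_tendsto_exp[OF _ tendsto_const, of u]] that
      by (cases "u > 0") (auto simp: exponential_density_def)
    show "AE u in lborel. (\<lambda>n. indicator {0..} u * rescaled (n + N) u) \<longlonglongrightarrow> exponential_density 1 u"
      using AE_lborel_singleton[of 0] by eventually_elim (rule pointwise)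
  qed (use rescaled.measurable_on_nonneg in auto)
  then have "(\<lambda>n. LINT u|lborel. indicator {0..} u * rescaled (n + N) u) \<longlonglongrightarrow> 1"
    using has_bochner_integral_exponential_density[of 1] by (simp add: has_bochner_integral_iff)
  then show ?thesis by (rule LIMSEQ_offset)
qed

definition mean :: "nat \<Rightarrow> real" where
  "mean n = (LINT t|lborel. indicator {0..} t * f n t)"

lemma mean_nonneg: "mean n \<ge> 0"
  unfolding mean_def using bounds
  by (intro Bochner_Integration.integral_nonneg) (simp add: indicator_def)

lemma mean_eq_level_time_mult:
  assumes "level_time n > 0"
  shows "mean n = level_time n * (LINT u|lborel. indicator {0..} u * rescaled n u)"
proof -
  have "indicator {0..} (0 + level_time n * u) = (indicator {0..} u :: real)" for u
    using assms by (simp add: indicator_def zero_le_mult_iff)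
  then show ?thesis
    unfolding mean_def rescaled_def
    using assms lborel_integral_real_affine[of "level_time n" "\<lambda>t. indicator {0..} t * f n t" 0]
    by simp
qed

lemma eventually_mean_pos: "eventually (\<lambda>n. mean n > 0) sequentially"
proof -
  have "eventually (\<lambda>n. (LINT u|lborel. indicator {0..} u * rescaled n u) > 0) sequentially"
    using rescaled_integral_tendsto by (rule order_tendstoD) simp
  then show ?thesis
    using eventually_gap_le_level_time by eventually_elim (simp add: mean_eq_level_time_mult)
qed

lemma survival_at_mean_tendsto_exp:
  assumes "x \<ge> 0"
  shows "(\<lambda>n. f n (mean n * x)) \<longlonglongrightarrow> exp (- x)"
proof (cases "x = 0")
  case False
  have "(\<lambda>n. (LINT u|lborel. indicator {0..} u * rescaled n u) * x) \<longlonglongrightarrow> 1 * x"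
    by (intro tendsto_intros rescaled_integral_tendsto)
  then have "(\<lambda>n. rescaled n ((LINT u|lborel. indicator {0..} u * rescaled n u) * x)) \<longlonglongrightarrow> exp (- x)"
    using False assms by (intro rescaled_tendsto_exp) auto
  moreover have "eventually (\<lambda>n. rescaled n ((LINT u|lborel. indicator {0..} u * rescaled n u) * x)
      = f n (mean n * x)) sequentially"
    using eventually_gap_le_level_time
    by eventually_elim (simp add: rescaled_def mean_eq_level_time_mult mult.assoc)
  ultimately show ?thesis by (rule Lim_transform_eventually)
qed (use start in simp)

end

section \<open>Probabilistic tools\<close>

lemma (in prob_space) expectation_eq_integral_tail:
  assumes [measurable]: "Y \<in> borel_measurable M" and nonneg: "AE \<omega> in M. Y \<omega> \<ge> 0"
  shows "expectation Y = (LINT t|lborel. indicator {0..} t * prob {\<omega> \<in> space M. t < Y \<omega>})"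
proof -
  interpret pair_sigma_finite M lborel by standard
  let ?f = "\<lambda>\<omega> t. indicator {0..} t * indicator {\<omega> \<in> space M. t < Y \<omega>} \<omega> :: ennreal"
  have "(\<integral>\<^sup>+\<omega>. ennreal (Y \<omega>) \<partial>M) = (\<integral>\<^sup>+\<omega>. (\<integral>\<^sup>+t. ?f \<omega> t \<partial>lborel) \<partial>M)"
  proof (rule nn_integral_cong_AE, use nonneg AE_space in eventually_elim)
    case (elim \<omega>)
    then have "(\<integral>\<^sup>+t. ?f \<omega> t \<partial>lborel) = (\<integral>\<^sup>+t. indicator {0..<Y \<omega>} t \<partial>lborel)"
      by (intro nn_integral_cong) (auto simp: indicator_def)
    then show ?case using elim by simp
  qed
  also have "\<dots> = (\<integral>\<^sup>+t. (\<integral>\<^sup>+\<omega>. ?f \<omega> t \<partial>M) \<partial>lborel)"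
    by (rule Fubini'[symmetric]) measurable
  also have "\<dots> = (\<integral>\<^sup>+t. ennreal (indicator {0..} t * prob {\<omega> \<in> space M. t < Y \<omega>}) \<partial>lborel)"
    by (simp add: nn_integral_cmult emeasure_eq_measure ennreal_mult ennreal_indicator)
  finally have "(\<integral>\<^sup>+\<omega>. ennreal (Y \<omega>) \<partial>M)
      = (\<integral>\<^sup>+t. ennreal (indicator {0..} t * prob {\<omega> \<in> space M. t < Y \<omega>}) \<partial>lborel)" .
  moreover have "mono (\<lambda>t. - prob {\<omega> \<in> space M. t < Y \<omega>})"
    by (intro monoI) (auto intro!: finite_measure_mono)
  then have "(\<lambda>t. - (- prob {\<omega> \<in> space M. t < Y \<omega>})) \<in> borel_measurable borel"
    by (intro borel_measurable_uminus borel_measurable_mono)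
  ultimately show ?thesis
    using nonneg by (simp add: integral_eq_nn_integral)
qed

lemma cdf_exponential_density:
  "l > 0 \<Longrightarrow>
    cdf (density lborel (exponential_density l)) x = (if 0 \<le> x then 1 - exp (- l * x) else 0)"
  by (simp add: cdf_def measure_def emeasure_erlang_density erlang_CDF_0)

lemma weak_conv_m_exponentialI:
  assumes "\<And>n. prob_space (M n)" and [measurable]: "\<And>n. Y n \<in> borel_measurable (M n)" and "l > 0"
    and tail: "\<And>x. x \<ge> 0 \<Longrightarrow> (\<lambda>n. measure (M n) {\<omega> \<in> space (M n). x < Y n \<omega>}) \<longlonglongrightarrow> exp (- l * x)"
  shows "weak_conv_m (\<lambda>n. distr (M n) borel (Y n)) (density lborel (exponential_density l))"
  unfolding weak_conv_m_def weak_conv_def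
proof (intro allI impI)
  fix x
  let ?tail = "\<lambda>x n. measure (M n) {\<omega> \<in> space (M n). x < Y n \<omega>}"
  interpret prob_space "M n" for n by (rule assms(1))
  have cdf: "cdf (distr (M n) borel (Y n)) x = 1 - ?tail x n" for n
  proof -
    have "cdf (distr (M n) borel (Y n)) x = prob n {\<omega> \<in> space (M n). \<not> x < Y n \<omega>}"
      by (simp add: cdf_def measure_distr vimage_def Int_def conj_commute not_less)
    then show ?thesis by (simp add: prob_neg)
  qed
  have "(\<lambda>n. ?tail x n) \<longlonglongrightarrow> (if 0 \<le> x then exp (- l * x) else 1)"
  proof (cases "0 \<le> x")
    case False
    have "(\<lambda>n. ?tail x n) \<longlonglongrightarrow> 1"
    proof (rule tendsto_sandwich[OF always_eventually always_eventually])
      show "\<forall>n. ?tail 0 n \<le> ?tail x n" using False by (auto intro!: finite_measure_mono)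
      show "(\<lambda>n. ?tail 0 n) \<longlonglongrightarrow> 1" using tail[of 0] by simp
      show "\<forall>n. ?tail x n \<le> 1" by simp
    qed simp
    then show ?thesis using False by simp
  qed (use tail in simp)
  then have "(\<lambda>n. 1 - ?tail x n) \<longlonglongrightarrow> 1 - (if 0 \<le> x then exp (- l * x) else 1)"
    by (intro tendsto_intros)
  then show "(\<lambda>n. cdf (distr (M n) borel (Y n)) x) \<longlonglongrightarrow> cdf (density lborel (exponential_density l)) x"
    using \<open>l > 0\<close> by (simp add: cdf cdf_exponential_density split: if_splits)
qed

lemma weak_conv_m_exponential_rescaledI:
  assumes "\<And>n. prob_space (M n)" and Y: "\<And>n. Y n \<in> borel_measurable (M n)" and "l > 0"
    and pos: "eventually (\<lambda>n. c n > 0) sequentially"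
    and tail: "\<And>x. x \<ge> 0 \<Longrightarrow> (\<lambda>n. measure (M n) {\<omega> \<in> space (M n). c n * x < Y n \<omega>}) \<longlonglongrightarrow> exp (- l * x)"
  shows "weak_conv_m (\<lambda>n. distr (M n) borel (\<lambda>\<omega>. Y n \<omega> / c n))
    (density lborel (exponential_density l))"
proof (intro weak_conv_m_exponentialI assms)
  fix x :: real assume "x \<ge> 0"
  have "eventually (\<lambda>n. measure (M n) {\<omega> \<in> space (M n). c n * x < Y n \<omega>}
      = measure (M n) {\<omega> \<in> space (M n). x < Y n \<omega> / c n}) sequentially"
    using pos by eventually_elim (simp add: pos_less_divide_eq mult.commute)
  with tail[OF \<open>x \<ge> 0\<close>]
  show "(\<lambda>n. measure (M n) {\<omega> \<in> space (M n). x < Y n \<omega> / c n}) \<longlonglongrightarrow> exp (- l * x)"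
    by (rule Lim_transform_eventually)
qed (use Y in measurable)

section \<open>The survival function of a hitting time\<close>

context ctmc
begin

definition survival :: "'a set \<Rightarrow> real \<Rightarrow> real" where
  "survival A t = prob (avoids A {0..t})"

lemma prob_never_hits:
  assumes "(survival A \<longlongrightarrow> 0) at_top"
  shows "avoids A {0..} \<in> events" "prob (avoids A {0..}) = 0"
proof -
  have Union: "(\<Union>n. {0..real n}) = {0..}"
    using real_arch_simple by (auto simp: set_eq_iff)
  have Inter: "avoids A {0..} = (\<Inter>n. avoids A {0..real n})"
    unfolding Union[symmetric] by (rule avoids_UN)
  show "avoids A {0..} \<in> events"
    unfolding Inter by (intro sets.countable_INT) (auto simp: avoids_Icc_event)
  have "(\<lambda>n. prob (avoids A {0..real n})) \<longlonglongrightarrow> prob (avoids A {0..})"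
    unfolding Inter
    by (intro finite_Lim_measure_decseq)
      (auto simp: avoids_Icc_event decseq_def intro!: avoids_antimono)
  moreover have "(\<lambda>n. prob (avoids A {0..real n})) \<longlonglongrightarrow> 0"
    using filterlim_compose[OF assms filterlim_real_sequentially] by (simp add: survival_def)
  ultimately show "prob (avoids A {0..}) = 0" by (rule LIMSEQ_unique)
qed

lemma hits_iff: "\<omega> \<in> space M - avoids A {0..} \<longleftrightarrow> \<omega> \<in> space M \<and> {t. t > 0 \<and> X t \<omega> \<in> A} \<noteq> {}"
  unfolding avoids_right_dense[OF right_dense_greaterThan order_refl, symmetric]
  by (auto simp: avoids_def)

lemma hitting_time_nonneg: "\<omega> \<in> space M - avoids A {0..} \<Longrightarrow> hitting_time X A \<omega> \<ge> 0"
  unfolding hits_iff hitting_time_def by (intro cInf_greatest) auto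

text \<open>On the null event that \<open>A\<close> is never hit the hitting time is the unspecified \<open>Inf {}\<close>.\<close>

lemma hitting_time_never:
  "\<omega> \<in> avoids A {0..} \<Longrightarrow> hitting_time X A \<omega> = Inf {}"
  unfolding hitting_time_def avoids_def by (intro arg_cong[where f = Inf]) auto

lemma hitting_time_gt_iff:
  assumes \<omega>: "\<omega> \<in> space M - avoids A {0..}" and "t \<ge> 0"
  shows "t < hitting_time X A \<omega> \<longleftrightarrow> \<omega> \<in> avoids A {0..t}"
proof -
  let ?T = "{t. t > 0 \<and> X t \<omega> \<in> A}"
  have space: "\<omega> \<in> space M" and nonempty: "?T \<noteq> {}" using \<omega> unfolding hits_iff by auto
  have "X s \<omega> \<notin> A" if "s \<in> {0<..<hitting_time X A \<omega>}" for s
    using that cInf_lower[of s ?T] unfolding hitting_time_def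
    by (force intro: bdd_belowI[of _ 0])
  then have "\<omega> \<in> avoids A {0<..<hitting_time X A \<omega>}" using space by (simp add: avoids_def)
  also have "\<dots> = avoids A {0..<hitting_time X A \<omega>}"
    by (intro avoids_right_dense right_dense_greaterThanLessThan) auto
  finally have avoids_before: "\<omega> \<in> avoids A {0..t}" if "t < hitting_time X A \<omega>"
    using that by (auto simp: avoids_def)
  have hits_after: "t < hitting_time X A \<omega>" if avoid: "\<omega> \<in> avoids A {0..t}"
  proof -
    obtain e where e: "e > 0" "\<And>s. t \<le> s \<Longrightarrow> s < t + e \<Longrightarrow> X s \<omega> = X t \<omega>"
      using X_right_continuous[OF space \<open>t \<ge> 0\<close>] by blast
    have "t + e \<le> hitting_time X A \<omega>"
      unfolding hitting_time_def
    proof (rule cInf_greatest[OF nonempty])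
      fix s assume "s \<in> ?T"
      then have "\<not> s \<le> t" "\<not> (t \<le> s \<and> s < t + e)"
        using avoid e(2)[of s] \<open>t \<ge> 0\<close> by (auto simp: avoids_def)
      then show "t + e \<le> s" by linarith
    qed
    then show ?thesis using e(1) by simp
  qed
  show ?thesis using avoids_before hits_after by blast
qed

context
  fixes A :: "'a set"
  assumes vanishing: "(survival A \<longlongrightarrow> 0) at_top"
begin

lemma AE_hits: "AE \<omega> in M. \<omega> \<in> space M - avoids A {0..}"
  using prob_never_hits[OF vanishing]
  by (intro AE_I[of _ _ "avoids A {0..}"]) (auto simp: emeasure_eq_measure)

lemma hitting_time_measurable [measurable]: "hitting_time X A \<in> borel_measurable M"
  unfolding borel_measurable_iff_greater
proof
  fix a :: real
  let ?N = "avoids A {0..}"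
  let ?hit = "if a \<ge> 0 then avoids A {0..a} - ?N else space M - ?N"
  let ?never = "if a < Inf {} then ?N else {}"
  have "a < hitting_time X A \<omega> \<longleftrightarrow> \<omega> \<in> ?hit \<union> ?never" if "\<omega> \<in> space M" for \<omega>
  proof (cases "\<omega> \<in> ?N")
    case True
    then show ?thesis by (simp add: hitting_time_never)
  next
    case False
    then have "\<omega> \<in> space M - ?N" using that by simp
    from hitting_time_gt_iff[OF this] hitting_time_nonneg[OF this] this show ?thesis by auto
  qed
  then have "{\<omega> \<in> space M. a < hitting_time X A \<omega>} = ?hit \<union> ?never"
    by (auto simp: avoids_def split: if_splits)
  then show "{\<omega> \<in> space M. a < hitting_time X A \<omega>} \<in> events"
    using prob_never_hits(1)[OF vanishing] avoids_Icc_event[of 0] by simp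
qed

lemma prob_hitting_time_gt:
  assumes "t \<ge> 0"
  shows "prob {\<omega> \<in> space M. t < hitting_time X A \<omega>} = survival A t"
  unfolding survival_def
proof (rule measure_eq_AE)
  show "AE \<omega> in M. \<omega> \<in> {\<omega> \<in> space M. t < hitting_time X A \<omega>} \<longleftrightarrow> \<omega> \<in> avoids A {0..t}"
    using AE_hits by eventually_elim (use hitting_time_gt_iff assms in auto)
qed (use avoids_Icc_event in auto)

lemma expectation_hitting_time:
  "expectation (hitting_time X A) = (LINT t|lborel. indicator {0..} t * survival A t)"
proof -
  have "AE \<omega> in M. hitting_time X A \<omega> \<ge> 0"
    using AE_hits by eventually_elim (rule hitting_time_nonneg)
  then have "expectation (hitting_time X A)
      = (LINT t|lborel. indicator {0..} t * prob {\<omega> \<in> space M. t < hitting_time X A \<omega>})"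
    by (intro expectation_eq_integral_tail) auto
  also have "\<dots> = (LINT t|lborel. indicator {0..} t * survival A t)"
    by (intro Bochner_Integration.integral_cong) (auto simp: indicator_def prob_hitting_time_gt)
  finally show ?thesis .
qed

end

end

context stationary_ctmc
begin

lemma survival_zero:
  assumes "A \<subseteq> Om"
  shows "survival A 0 = 1 - (\<Sum>x\<in>A. \<nu> x)"
proof -
  have "survival A 0 = (\<Sum>x\<in>Om - A. \<nu> x)"
    using prob_avoids_times[of "\<lambda>_. 0" 0 A] by (simp add: survival_def)
  also have "\<dots> = 1 - (\<Sum>x\<in>A. \<nu> x)"
    using assms finite_states nu_sum by (simp add: sum_diff)
  finally show ?thesis .
qed

lemma survival_function_survival:
  assumes "A \<subseteq> Om"
  shows "survival_function (survival A) (rate_into Om R \<nu> A)"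
proof
  show "antimono_on {0..} (survival A)"
    unfolding survival_def
    by (intro monotone_onI finite_measure_mono avoids_antimono avoids_Icc_event) auto
  fix t h :: real assume "t \<ge> 0" "h \<ge> 0"
  have "survival A t - survival A (t + h) = prob (avoids A {0..t} - avoids A {0..t + h})"
    unfolding survival_def using \<open>h \<ge> 0\<close>
    by (intro finite_measure_Diff[symmetric] avoids_antimono avoids_Icc_event) auto
  also have "\<dots> \<le> prob (avoids A {t} - avoids A {t..t + h})"
  proof (rule finite_measure_mono)
    have "{0..t + h} = {0..t} \<union> {t..t + h}" using \<open>t \<ge> 0\<close> \<open>h \<ge> 0\<close> by auto
    then show "avoids A {0..t} - avoids A {0..t + h} \<subseteq> avoids A {t} - avoids A {t..t + h}"
      using \<open>t \<ge> 0\<close> by (auto simp: avoids_Un) (auto simp: avoids_def)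
  qed (use \<open>t \<ge> 0\<close> in \<open>auto intro!: sets.Diff avoids_finite_event avoids_Icc_event\<close>)
  also have "\<dots> \<le> rate_into Om R \<nu> A * h" using \<open>t \<ge> 0\<close> \<open>h \<ge> 0\<close> assms by (rule prob_enter_le)
  finally show "survival A t - survival A (t + h) \<le> rate_into Om R \<nu> A * h" .
qed (simp add: survival_def)

lemma survival_gap_multiplicative:
  assumes "A \<subseteq> Om" "mixed S D"
  shows "survival_function.gap_multiplicative (survival A) (rate_into Om R \<nu> A) S D"
proof -
  interpret survival_function "survival A" "rate_into Om R \<nu> A"
    using assms(1) by (rule survival_function_survival)
  have S: "S \<ge> 0" using assms(2) by (simp add: mixed_def)
  {
    fix t s :: real assume "t \<ge> 0" "s \<ge> 0"
    have whole: "{0..t + S + s} = {0..t} \<union> {t..t + S} \<union> {t + S..t + S + s}"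
      using \<open>t \<ge> 0\<close> \<open>s \<ge> 0\<close> S by auto
    let ?both = "avoids A ({0..t} \<union> {t + S..t + S + s})"
    let ?enter = "avoids A {t} - avoids A {t..t + S}"
    have events: "?both \<in> events" "?enter \<in> events" "avoids A {0..t + S + s} \<in> events"
      using \<open>t \<ge> 0\<close> S
      by (auto simp: avoids_Un intro!: sets.Int sets.Diff avoids_finite_event avoids_Icc_event)
    have decouple: "\<bar>prob ?both - survival A t * survival A s\<bar> \<le> survival A t * D"
      unfolding survival_def using \<open>t \<ge> 0\<close> \<open>s \<ge> 0\<close> assms(2) by (rule prob_avoids_decouple)
    have "survival A (t + S + s) \<le> prob ?both"
      unfolding survival_def using events
      by (intro finite_measure_mono avoids_antimono) (auto simp: whole)
    moreover have "?both \<subseteq> avoids A {0..t + S + s} \<union> ?enter"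
      using \<open>t \<ge> 0\<close> unfolding whole avoids_Un by (auto simp: avoids_def)
    then have "prob ?both \<le> prob (avoids A {0..t + S + s} \<union> ?enter)"
      using events by (intro finite_measure_mono) auto
    then have "prob ?both \<le> survival A (t + S + s) + rate_into Om R \<nu> A * S"
      using measure_Un_le[OF events(3,2)] prob_enter_le[OF \<open>t \<ge> 0\<close> S assms(1)]
      by (simp add: survival_def)
    ultimately have "survival A (t + S + s) \<le> survival A t * (survival A s + D)"
      "survival A t * (survival A s - D) \<le> survival A (t + S + s) + rate_into Om R \<nu> A * S"
      using decouple by (auto simp: distrib_left right_diff_distrib)
  }
  then show ?thesis
    using S mixed_bound_nonneg[OF assms(2)] by (simp add: gap_multiplicative_def)
qed

lemma survival_tendsto_0:
  assumes "A \<subseteq> Om" "A \<noteq> {}"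
  shows "(survival A \<longlongrightarrow> 0) at_top"
proof -
  interpret survival_function "survival A" "rate_into Om R \<nu> A"
    using assms(1) by (rule survival_function_survival)
  define D where "D = (\<Sum>x\<in>A. \<nu> x) / 2"
  have "D > 0"
    unfolding D_def using assms finite_states nu_pos
    by (intro half_gt_zero sum_pos) (auto intro: finite_subset)
  then obtain S where S: "S > 0" "mixed S D" using exists_mixed by blast
  have "survival A S + D \<le> 1 - D"
    using decreasing[of 0 S] S(1) survival_zero[OF assms(1)] by (simp add: D_def)
  moreover have "1 - D > 0" using calculation bounds[of S] S(1) \<open>D > 0\<close> by simp
  ultimately have "contracting (2 * S) (1 - D)"
    using S \<open>D > 0\<close> survival_gap_multiplicative[OF assms(1)]
    by (intro gap_multiplicative_contracting[of S D S]) auto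
  then show ?thesis by (rule contracting_tendsto_0)
qed

end

section \<open>The exponential limit\<close>

lemma exists_slowly_diverging_nat_seq:
  fixes \<rho> :: "nat \<Rightarrow> real"
  assumes "\<And>n. \<rho> n > 0" "\<rho> \<longlonglongrightarrow> 0"
  obtains k :: "nat \<Rightarrow> nat" where "\<And>n. k n > 0" "filterlim k at_top sequentially"
    "(\<lambda>n. real (k n) * \<rho> n) \<longlonglongrightarrow> 0"
proof
  let ?k = "\<lambda>n. Suc (nat \<lfloor>inverse (sqrt (\<rho> n))\<rfloor>)"
  show "?k n > 0" for n by simp
  have sqrt: "(\<lambda>n. sqrt (\<rho> n)) \<longlonglongrightarrow> 0" using tendsto_real_sqrt[OF assms(2)] by simp
  then have "filterlim (\<lambda>n. inverse (sqrt (\<rho> n))) at_top sequentially"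
    using assms(1) by (intro filterlim_inverse_at_top) auto
  then show "filterlim ?k at_top sequentially"
    by (intro filterlim_compose[OF filterlim_Suc] filterlim_compose[OF filterlim_nat_sequentially]
        filterlim_compose[OF filterlim_floor_sequentially])
  show "(\<lambda>n. real (?k n) * \<rho> n) \<longlonglongrightarrow> 0"
  proof (rule tendsto_sandwich[OF always_eventually always_eventually tendsto_const])
    show "\<forall>n. 0 \<le> real (?k n) * \<rho> n" using assms(1) by (simp add: less_imp_le)
    show "(\<lambda>n. sqrt (\<rho> n) + \<rho> n) \<longlonglongrightarrow> 0" using tendsto_add[OF sqrt assms(2)] by simp
    show "\<forall>n. real (?k n) * \<rho> n \<le> sqrt (\<rho> n) + \<rho> n"
    proof
      fix n
      have "real (?k n) \<le> inverse (sqrt (\<rho> n)) + 1"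
        using assms(1)[of n] by (simp add: less_imp_le)
      then have "real (?k n) * \<rho> n \<le> (inverse (sqrt (\<rho> n)) + 1) * \<rho> n"
        using assms(1)[of n] by (intro mult_right_mono) auto
      also have "\<dots> = \<rho> n / sqrt (\<rho> n) + \<rho> n" by (simp add: field_simps)
      finally show "real (?k n) * \<rho> n \<le> sqrt (\<rho> n) + \<rho> n"
        using assms(1)[of n] by (simp add: real_div_sqrt)
    qed
  qed
qed

lemma exists_mixing_gaps:
  assumes "\<And>n. stationary_chain (Om n) (R n) (\<nu> n)" and r: "\<And>n. r n > 0"
    and mixing: "(\<lambda>n. mixing_time (Om n) (R n) (\<nu> n) / inverse (r n)) \<longlonglongrightarrow> 0"
  obtains S D :: "nat \<Rightarrow> real" where "\<And>n. stationary_chain.mixed (Om n) (R n) (\<nu> n) (S n) (D n)"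
    "D \<longlonglongrightarrow> 0" "(\<lambda>n. r n * S n) \<longlonglongrightarrow> 0"
proof -
  interpret stationary_chain "Om n" "R n" "\<nu> n" for n by (rule assms(1))
  have "\<exists>t>0. mixed n t (1 / 2) \<and>
      t < mixing_time (Om n) (R n) (\<nu> n) + inverse (real (Suc n)) / r n" for n
    using r by (intro exists_mixed_near_mixing_time) simp
  then obtain T where T: "\<And>n. T n > 0" "\<And>n. mixed n (T n) (1 / 2)"
    "\<And>n. T n < mixing_time (Om n) (R n) (\<nu> n) + inverse (real (Suc n)) / r n" by metis
  have "(\<lambda>n. T n * r n) \<longlonglongrightarrow> 0"
  proof (rule tendsto_sandwich[OF always_eventually always_eventually tendsto_const])
    show "\<forall>n. 0 \<le> T n * r n" using T(1) r by (simp add: less_imp_le)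
    show "\<forall>n. T n * r n \<le> mixing_time (Om n) (R n) (\<nu> n) / inverse (r n) + inverse (real (Suc n))"
    proof
      fix n
      have "T n * r n \<le> (mixing_time (Om n) (R n) (\<nu> n) + inverse (real (Suc n)) / r n) * r n"
        using T(3)[of n] r[of n] by simp
      then show "T n * r n
          \<le> mixing_time (Om n) (R n) (\<nu> n) / inverse (r n) + inverse (real (Suc n))"
        using r[of n] by (simp add: distrib_right divide_inverse mult.assoc)
    qed
    show "(\<lambda>n. mixing_time (Om n) (R n) (\<nu> n) / inverse (r n) + inverse (real (Suc n))) \<longlonglongrightarrow> 0"
      using tendsto_add[OF mixing LIMSEQ_inverse_real_of_nat] by simp
  qed
  then obtain k :: "nat \<Rightarrow> nat" where k: "\<And>n. k n > 0" "filterlim k at_top sequentially"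
    "(\<lambda>n. real (k n) * (T n * r n)) \<longlonglongrightarrow> 0"
    using exists_slowly_diverging_nat_seq[of "\<lambda>n. T n * r n"] T(1) r by auto
  show thesis
  proof
    show "mixed n (real (k n) * T n) ((1 / 2) ^ k n)" for n using T(2) k(1) by (rule mixed_power)
    show "(\<lambda>n. (1 / 2 :: real) ^ k n) \<longlonglongrightarrow> 0"
      by (intro filterlim_compose[OF _ k(2)] LIMSEQ_power_zero) simp
    show "(\<lambda>n. r n * (real (k n) * T n)) \<longlonglongrightarrow> 0" using k(3) by (simp add: ac_simps)
  qed
qed

theorem theorem3p1:
  fixes Om :: "nat \<Rightarrow> 'a set"
    and R :: "nat \<Rightarrow> 'a \<Rightarrow> 'a \<Rightarrow> real"
    and \<nu> :: "nat \<Rightarrow> 'a \<Rightarrow> real"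
    and A :: "nat \<Rightarrow> 'a set"
    and M :: "nat \<Rightarrow> 'b measure"
    and X :: "nat \<Rightarrow> real \<Rightarrow> 'b \<Rightarrow> 'a"
  assumes fin: "\<And>N. finite (Om N)"
    and nonempty: "\<And>N. Om N \<noteq> {}"
    and rates: "\<And>N. nonneg_rates (Om N) (R N)"
    and irred: "\<And>N. irreducible_chain (Om N) (R N)"
    and stat: "\<And>N. unique_stationary (Om N) (R N) (\<nu> N)"
    and proc: "\<And>N. ctmc_process (M N) (X N) (Om N) (R N) (\<nu> N)"
    and A_sub: "\<And>N. A N \<subseteq> Om N"
    and A_small: "(\<lambda>N. \<Sum>x\<in>A N. \<nu> N x) \<longlonglongrightarrow> 0"
    and r_pos: "\<And>N. rate_into (Om N) (R N) (\<nu> N) (A N) > 0"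
    and mix: "(\<lambda>N. mixing_time (Om N) (R N) (\<nu> N) / inverse (rate_into (Om N) (R N) (\<nu> N) (A N)))
                \<longlonglongrightarrow> 0"
  shows "weak_conv_m
           (\<lambda>N. distr (M N) borel
              (\<lambda>\<omega>. hitting_time (X N) (A N) \<omega> / (\<integral>\<omega>'. hitting_time (X N) (A N) \<omega>' \<partial>M N)))
           (density lborel (exponential_density 1))"
proof -
  interpret stationary_ctmc "Om N" "R N" "\<nu> N" "M N" "X N" for N
    using fin rates irred stat proc
    by (intro stationary_ctmc.intro stationary_chain.intro ctmc.intro finite_rates.intro
        stationary_chain_axioms.intro ctmc_axioms.intro)
      (auto simp: unique_stationary_def ctmc_process_def)
  let ?r = "\<lambda>N. rate_into (Om N) (R N) (\<nu> N) (A N)"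
  obtain S D where gaps: "\<And>N. mixed N (S N) (D N)" "D \<longlonglongrightarrow> 0" "(\<lambda>N. ?r N * S N) \<longlonglongrightarrow> 0"
    using exists_mixing_gaps[OF stationary_chain_axioms r_pos mix] by blast
  have vanishing: "(survival N (A N) \<longlongrightarrow> 0) at_top" for N
    using A_sub r_pos[of N] by (intro survival_tendsto_0) (auto simp: rate_into_def)
  interpret survival_sequence "\<lambda>N. survival N (A N)" ?r S D
    using A_sub r_pos vanishing gaps tendsto_diff[OF tendsto_const A_small, of 1]
    by (intro survival_sequence.intro)
      (simp_all add: survival_function_survival survival_gap_multiplicative survival_zero)
  have mean: "(\<integral>\<omega>. hitting_time (X N) (A N) \<omega> \<partial>M N) = mean N" for N
    unfolding mean_def by (rule expectation_hitting_time[OF vanishing])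
  have "(\<lambda>N. prob N {\<omega> \<in> space (M N). mean N * x < hitting_time (X N) (A N) \<omega>}) \<longlonglongrightarrow> exp (- 1 * x)"
    if "x \<ge> 0" for x
    using survival_at_mean_tendsto_exp[OF that] mean_nonneg that
    by (simp add: prob_hitting_time_gt[OF vanishing])
  then show ?thesis
    unfolding mean using hitting_time_measurable[OF vanishing] eventually_mean_pos
    by (intro weak_conv_m_exponential_rescaledI prob_space_axioms) auto
qed

end
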